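(* Let $\mathbb{F}$ be a field and let $f$ be an $n$-variate polynomial of degree $d$ over $\mathbb{F}$ computed by a homogeneous formula of size $s$ and product-depth $\Delta$. Then for any parameter $t = o(d)$, $f$ can be equivalently computed by a homogeneous $\Sigma\Pi^{[a]}\Sigma\Pi^{[t]}$ circuit with $a = \Theta\!\left(\frac{d}{t}\cdot t^{1/\Delta}\right)$, of top fan-in at most $s^{O(d/t)}$ and size $s^{O(t + d/t)}$.
   Context: The product-depth of a formula is the maximum number of multiplication gates encountered on any path from the output (root) to an input (leaf). A homogeneous circuit/formula is one in which every gate computes a homogeneous polynomial. A $\Sigma\Pi\Sigma\Pi^{[t]}$ circuit is a depth-four circuit with an addition gate at the output, whose children are multiplication gates, whose children are addition gates, whose children are multiplication gates of fan-in at most $t$ whose inputs are variables or field constants. A $\Sigma\Pi^{[a]}\Sigma\Pi^{[t]}$ circuit is a $\Sigma\Pi\Sigma\Pi^{[t]}$ circuit in which every multiplication gate adjacent to the output gate has fan-in at least $a$ (i.e., computes a product of at least $a$ non-trivial factors). The top fan-in is the fan-in of the output gate. *)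

theory Defs
  imports
    Complex_Main
    "HOL-Library.Poly_Mapping"
    "HOL-Library.Landau_Symbols"
begin

section \<open>Multivariate polynomials\<close>

text \<open>Polynomials in the variables $x_0, x_1, \ldots$: finitely supported maps from monomials
  (finitely supported exponent vectors) to coefficients, with the convolution product.\<close>

type_synonym 'a mpoly = "(nat \<Rightarrow>\<^sub>0 nat) \<Rightarrow>\<^sub>0 'a"

definition mp_var :: "nat \<Rightarrow> 'a::field mpoly" where
  "mp_var i = Poly_Mapping.single (Poly_Mapping.single i 1) 1"

definition mp_const :: "'a \<Rightarrow> 'a::field mpoly" where
  "mp_const c = Poly_Mapping.single 0 c"

definition mon_degree :: "(nat \<Rightarrow>\<^sub>0 nat) \<Rightarrow> nat" where
  "mon_degree m = (\<Sum>i\<in>Poly_Mapping.keys m. Poly_Mapping.lookup m i)"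

text \<open>The zero polynomial has degree 0 here.\<close>

definition total_degree :: "'a::field mpoly \<Rightarrow> nat" where
  "total_degree p = Max (insert 0 (mon_degree ` Poly_Mapping.keys p))"

definition mp_vars :: "'a::field mpoly \<Rightarrow> nat set" where
  "mp_vars p = (\<Union>m\<in>Poly_Mapping.keys p. Poly_Mapping.keys m)"

text \<open>The zero polynomial counts as homogeneous (of every degree).\<close>

definition homogeneous_poly :: "'a::field mpoly \<Rightarrow> bool" where
  "homogeneous_poly p \<longleftrightarrow> (\<exists>k. \<forall>m\<in>Poly_Mapping.keys p. mon_degree m = k)"


section \<open>Formulas\<close>

text \<open>Gates have arbitrary fan-in, and edges carry no scalars: a field constant enters only
  through a leaf.\<close>

datatype 'a formula =
    FVar nat
  | FConst 'a
  | FAdd "'a formula list"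
  | FMul "'a formula list"

fun formula_poly :: "'a::field formula \<Rightarrow> 'a mpoly" where
  "formula_poly (FVar i) = mp_var i"
| "formula_poly (FConst c) = mp_const c"
| "formula_poly (FAdd \<phi>s) = sum_list (map formula_poly \<phi>s)"
| "formula_poly (FMul \<phi>s) = prod_list (map formula_poly \<phi>s)"

fun formula_vars :: "'a formula \<Rightarrow> nat set" where
  "formula_vars (FVar i) = {i}"
| "formula_vars (FConst c) = {}"
| "formula_vars (FAdd \<phi>s) = (\<Union>\<phi>\<in>set \<phi>s. formula_vars \<phi>)"
| "formula_vars (FMul \<phi>s) = (\<Union>\<phi>\<in>set \<phi>s. formula_vars \<phi>)"

text \<open>Size is the number of nodes of the tree, leaves included.\<close>

fun formula_size :: "'a formula \<Rightarrow> nat" where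
  "formula_size (FVar i) = 1"
| "formula_size (FConst c) = 1"
| "formula_size (FAdd \<phi>s) = 1 + sum_list (map formula_size \<phi>s)"
| "formula_size (FMul \<phi>s) = 1 + sum_list (map formula_size \<phi>s)"

fun product_depth :: "'a formula \<Rightarrow> nat" where
  "product_depth (FVar i) = 0"
| "product_depth (FConst c) = 0"
| "product_depth (FAdd \<phi>s) = Max (insert 0 (product_depth ` set \<phi>s))"
| "product_depth (FMul \<phi>s) = 1 + Max (insert 0 (product_depth ` set \<phi>s))"

fun homogeneous_formula :: "'a::field formula \<Rightarrow> bool" where
  "homogeneous_formula (FVar i) = True"
| "homogeneous_formula (FConst c) = True"
| "homogeneous_formula (FAdd \<phi>s) \<longleftrightarrow>
     homogeneous_poly (formula_poly (FAdd \<phi>s)) \<and> (\<forall>\<phi>\<in>set \<phi>s. homogeneous_formula \<phi>)"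
| "homogeneous_formula (FMul \<phi>s) \<longleftrightarrow>
     homogeneous_poly (formula_poly (FMul \<phi>s)) \<and> (\<forall>\<phi>\<in>set \<phi>s. homogeneous_formula \<phi>)"


section \<open>Circuits\<close>

text \<open>A circuit is a directed acyclic graph, given as the list of its gates in topological order:
  the numbers in an addition or multiplication gate are the positions of its children, which must
  precede it. A child may be listed repeatedly (parallel wires). The last gate is the output.\<close>

datatype 'a gate =
    Input nat
  | Scalar 'a
  | Plus "nat list"
  | Times "nat list"

type_synonym 'a circuit = "'a gate list"

fun gate_children :: "'a gate \<Rightarrow> nat list" where
  "gate_children (Input i) = []"
| "gate_children (Scalar c) = []"
| "gate_children (Plus ks) = ks"
| "gate_children (Times ks) = ks"

definition wf_circuit :: "nat \<Rightarrow> 'a circuit \<Rightarrow> bool" where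
  "wf_circuit n C \<longleftrightarrow> C \<noteq> [] \<and>
     (\<forall>k<length C. \<forall>j\<in>set (gate_children (C ! k)). j < k) \<and>
     (\<forall>i. Input i \<in> set C \<longrightarrow> i < n)"

fun gate_poly :: "'a::field mpoly list \<Rightarrow> 'a gate \<Rightarrow> 'a mpoly" where
  "gate_poly ps (Input i) = mp_var i"
| "gate_poly ps (Scalar c) = mp_const c"
| "gate_poly ps (Plus ks) = sum_list (map (\<lambda>k. ps ! k) ks)"
| "gate_poly ps (Times ks) = prod_list (map (\<lambda>k. ps ! k) ks)"

text \<open>The list of the polynomials computed at all the gates, in the same order.\<close>

definition circuit_polys :: "'a::field circuit \<Rightarrow> 'a mpoly list" where
  "circuit_polys C = foldl (\<lambda>ps g. ps @ [gate_poly ps g]) [] C"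

definition circuit_poly :: "'a::field circuit \<Rightarrow> 'a mpoly" where
  "circuit_poly C = last (circuit_polys C)"

definition homogeneous_circuit :: "'a::field circuit \<Rightarrow> bool" where
  "homogeneous_circuit C \<longleftrightarrow> (\<forall>p\<in>set (circuit_polys C). homogeneous_poly p)"

text \<open>Size counts gates and wires.\<close>

definition circuit_size :: "'a circuit \<Rightarrow> nat" where
  "circuit_size C = length C + sum_list (map (\<lambda>g. length (gate_children g)) C)"

definition top_fanin :: "'a circuit \<Rightarrow> nat" where
  "top_fanin C = length (gate_children (last C))"

text \<open>$\Sigma\Pi\Sigma\Pi^{[t]}$\<close>

definition bottom_product :: "nat \<Rightarrow> 'a circuit \<Rightarrow> nat \<Rightarrow> bool" where
  "bottom_product t C k \<longleftrightarrow> (\<exists>ls. C ! k = Times ls \<and> length ls \<le> t \<and>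
     (\<forall>l\<in>set ls. (\<exists>i. C ! l = Input i) \<or> (\<exists>c. C ! l = Scalar c)))"

definition bottom_sum :: "nat \<Rightarrow> 'a circuit \<Rightarrow> nat \<Rightarrow> bool" where
  "bottom_sum t C k \<longleftrightarrow> (\<exists>ls. C ! k = Plus ls \<and> (\<forall>l\<in>set ls. bottom_product t C l))"

definition top_product :: "nat \<Rightarrow> 'a circuit \<Rightarrow> nat \<Rightarrow> bool" where
  "top_product t C k \<longleftrightarrow> (\<exists>ls. C ! k = Times ls \<and> (\<forall>l\<in>set ls. bottom_sum t C l))"

definition depth_four :: "nat \<Rightarrow> 'a circuit \<Rightarrow> bool" where
  "depth_four t C \<longleftrightarrow> (\<exists>ls. last C = Plus ls \<and> (\<forall>l\<in>set ls. top_product t C l))"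

text \<open>$\Sigma\Pi^{[a]}\Sigma\Pi^{[t]}$: a factor is non-trivial if it computes a non-constant
  polynomial. Constant factors may be present in addition, but do not count towards $a$.\<close>

definition nontrivial_fanin :: "'a::field circuit \<Rightarrow> nat \<Rightarrow> nat" where
  "nontrivial_fanin C k =
     length (filter (\<lambda>l. total_degree (circuit_polys C ! l) > 0) (gate_children (C ! k)))"

definition depth_four_fanin :: "nat \<Rightarrow> nat \<Rightarrow> 'a::field circuit \<Rightarrow> bool" where
  "depth_four_fanin a t C \<longleftrightarrow> depth_four t C \<and>
     (\<forall>l\<in>set (gate_children (last C)). nontrivial_fanin C l \<ge> a)"

end

theory Submission
  imports Defs
begin

text \<open>A formula of degree above \<open>\<tau>\<close> is expanded into products of subformulas of degree at most
  \<open>\<tau>\<close>. As the size of a formula is additive over its subformulas, while the degrees of the factors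
  of a product add up, this produces only \<open>s\<close> to the power \<open>d / \<tau>\<close> terms. If a term has fewer than
  \<open>d / \<tau> \<cdot> \<tau> powr (1 / \<Delta>) / 4\<close> non-constant factors, then at least \<open>d / (2 * \<tau>)\<close> of them have degree
  above \<open>\<tau> powr (1 - 1 / \<Delta>)\<close>. Their product-depth is below \<open>\<Delta>\<close>, so following the child of largest
  degree one meets a product gate with at least \<open>\<tau> powr (1 / \<Delta>)\<close> non-constant factors; expanding a
  factor down to this gate multiplies the number of terms by at most \<open>s\<close>, and doing so for
  \<open>d / (2 * \<tau>)\<close> factors gives the fan-in. The threshold is \<open>\<tau> = t - 1\<close>, since the coefficient of a
  monomial takes up one of the \<open>t\<close> inputs of a bottom product.\<close>

section \<open>Homogeneous polynomials\<close>

text \<open>Write r for the root \<open>\<tau> powr (1 / \<Delta>)\<close>. The degree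
  \<open>r ^ (\<Delta> - 1)\<close> separating light from heavy factors balances two ways of getting
  many factors. If light factors carry a constant share of the degree d, there are about
  \<open>d / r ^ (\<Delta> - 1)\<close>, that is \<open>d / \<tau> * r\<close>, of them. If heavy
  ones do, there are about \<open>d / \<tau>\<close> of these, and each can be split into r pieces.
  The exponent is \<Delta> - 1 because opening a formula of degree above \<tau> passes a product
  gate, so every factor has lost one level of product-depth.

  Two features of formulas need care. A gate may compute 0, whose degree is 0 by convention, and a
  homogeneous sum may have summands of other degrees that cancel; both are discarded before degrees
  are added. And the number n of variables may exceed s; only the variables at the leaves, at most s
  many, enter the estimates, so a factor of degree k has at most \<open>s ^ k\<close> monomials and
  can be written out in full at the bottom of the circuit.\<close>

definition hom_of_degree :: "nat \<Rightarrow> 'a::field mpoly \<Rightarrow> bool" where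
  "hom_of_degree k p \<longleftrightarrow> (\<forall>m\<in>Poly_Mapping.keys p. mon_degree m = k)"

lemma homogeneous_poly_iff: "homogeneous_poly p \<longleftrightarrow> (\<exists>k. hom_of_degree k p)"
  by (simp add: homogeneous_poly_def hom_of_degree_def)

lemma hom_of_degree_imp_homogeneous: "hom_of_degree k p \<Longrightarrow> homogeneous_poly p"
  by (auto simp: homogeneous_poly_iff)

lemma mon_degree_superset:
  assumes "finite A" "Poly_Mapping.keys m \<subseteq> A"
  shows "mon_degree m = (\<Sum>i\<in>A. Poly_Mapping.lookup m i)"
  unfolding mon_degree_def using assms
  by (intro sum.mono_neutral_left) (auto simp: in_keys_iff)

lemma mon_degree_0 [simp]: "mon_degree 0 = 0"
  by (simp add: mon_degree_def)

lemma mon_degree_single [simp]: "mon_degree (Poly_Mapping.single i k) = k"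
  by (simp add: mon_degree_def)

lemma mon_degree_add: "mon_degree (m + m') = mon_degree m + mon_degree m'"
proof -
  let ?A = "Poly_Mapping.keys m \<union> Poly_Mapping.keys m'"
  have "mon_degree (m + m') = (\<Sum>i\<in>?A. Poly_Mapping.lookup (m + m') i)"
    by (rule mon_degree_superset) (auto simp: Poly_Mapping.keys_add)
  also have "\<dots> = (\<Sum>i\<in>?A. Poly_Mapping.lookup m i) + (\<Sum>i\<in>?A. Poly_Mapping.lookup m' i)"
    by (simp add: lookup_add sum.distrib)
  also have "\<dots> = mon_degree m + mon_degree m'"
    by (simp add: mon_degree_superset[of ?A m] mon_degree_superset[of ?A m'])
  finally show ?thesis .
qed

lemma mon_degree_eq_0_iff: "mon_degree m = 0 \<longleftrightarrow> m = 0"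
  by (auto simp: mon_degree_def in_keys_iff intro!: poly_mapping_eqI)

lemma hom_of_degree_0 [simp]: "hom_of_degree k 0"
  by (simp add: hom_of_degree_def)

lemma hom_of_degree_add: "hom_of_degree k p \<Longrightarrow> hom_of_degree k q \<Longrightarrow> hom_of_degree k (p + q)"
  using Poly_Mapping.keys_add[of p q] by (auto simp: hom_of_degree_def)

lemma hom_of_degree_mult:
  "hom_of_degree k p \<Longrightarrow> hom_of_degree l q \<Longrightarrow> hom_of_degree (k + l) (p * q)"
  using keys_mult[of p q] by (fastforce simp: hom_of_degree_def mon_degree_add)

lemma hom_of_degree_1 [simp]: "hom_of_degree 0 1"
  by (simp add: hom_of_degree_def)

lemma hom_of_degree_single: "hom_of_degree (mon_degree m) (Poly_Mapping.single m c)"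
  by (simp add: hom_of_degree_def)

lemma hom_of_degree_mp_var: "hom_of_degree 1 (mp_var i)"
  unfolding mp_var_def using hom_of_degree_single[of "Poly_Mapping.single i 1"] by simp

lemma hom_of_degree_mp_const: "hom_of_degree 0 (mp_const c)"
  unfolding mp_const_def using hom_of_degree_single[of 0 c] by simp

lemma hom_of_degree_sum_list:
  "(\<And>x. x \<in> set xs \<Longrightarrow> hom_of_degree k (g x)) \<Longrightarrow> hom_of_degree k (\<Sum>x\<leftarrow>xs. g x)"
  by (induction xs) (auto intro: hom_of_degree_add)

lemma hom_of_degree_prod_list:
  "(\<And>x. x \<in> set xs \<Longrightarrow> hom_of_degree (h x) (g x)) \<Longrightarrow>
    hom_of_degree (\<Sum>x\<leftarrow>xs. h x) (\<Prod>x\<leftarrow>xs. g x)"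
  by (induction xs) (auto intro: hom_of_degree_mult)

lemma homogeneous_poly_prod_list:
  assumes "\<And>x. x \<in> set xs \<Longrightarrow> homogeneous_poly (g x)"
  shows "homogeneous_poly (\<Prod>x\<leftarrow>xs. g x)"
proof -
  from assms have "\<forall>x\<in>set xs. \<exists>k. hom_of_degree k (g x)"
    by (simp add: homogeneous_poly_iff)
  then obtain h where "\<And>x. x \<in> set xs \<Longrightarrow> hom_of_degree (h x) (g x)"
    by metis
  then show ?thesis
    using hom_of_degree_prod_list hom_of_degree_imp_homogeneous by metis
qed

lemma total_degree_hom:
  assumes "hom_of_degree k p" "p \<noteq> 0"
  shows "total_degree p = k"
proof -
  have "mon_degree ` Poly_Mapping.keys p = {k}"
    using assms by (auto simp: hom_of_degree_def image_iff) (metis keys_eq_empty ex_in_conv)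
  then show ?thesis
    by (simp add: total_degree_def)
qed

lemma total_degree_0 [simp]: "total_degree 0 = 0"
  by (simp add: total_degree_def)

lemma homogeneous_poly_total_degree:
  "homogeneous_poly p \<longleftrightarrow> hom_of_degree (total_degree p) p"
  by (metis hom_of_degree_0 homogeneous_poly_iff total_degree_hom)

lemma lookup_sum_list:
  "Poly_Mapping.lookup (\<Sum>x\<leftarrow>xs. g x) m = (\<Sum>x\<leftarrow>xs. Poly_Mapping.lookup (g x) m)"
  by (induction xs) (auto simp: lookup_add)

lemma poly_eq_sum_keys:
  "p = (\<Sum>m\<in>Poly_Mapping.keys p. Poly_Mapping.single m (Poly_Mapping.lookup p m))"
proof (rule poly_mapping_eqI)
  fix m
  show "Poly_Mapping.lookup p m = Poly_Mapping.lookup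
      (\<Sum>m\<in>Poly_Mapping.keys p. Poly_Mapping.single m (Poly_Mapping.lookup p m)) m"
    by (auto simp: lookup_sum lookup_single when_def in_keys_iff)
qed


subsection \<open>Monomials\<close>

definition var_monomial :: "nat list \<Rightarrow> (nat \<Rightarrow>\<^sub>0 nat)" where
  "var_monomial is = (\<Sum>i\<leftarrow>is. Poly_Mapping.single i 1)"

lemma var_monomial_surj: "\<exists>is. length is = mon_degree m \<and> set is = Poly_Mapping.keys m \<and> var_monomial is = m"
proof (induction "mon_degree m" arbitrary: m)
  case 0
  then show ?case
    by (intro exI[of _ "[]"]) (simp add: mon_degree_eq_0_iff var_monomial_def)
next
  case (Suc k)
  then have "m \<noteq> 0" by auto
  then obtain i where i: "i \<in> Poly_Mapping.keys m"
    by (metis keys_eq_empty ex_in_conv)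
  define m' where "m' = m - Poly_Mapping.single i 1"
  have m: "m = Poly_Mapping.single i 1 + m'"
    using i by (intro poly_mapping_eqI)
      (auto simp: m'_def lookup_add lookup_minus lookup_single when_def in_keys_iff)
  with Suc.hyps(2) have "k = mon_degree m'"
    by (metis One_nat_def Suc_eq_plus1_left add_left_cancel mon_degree_add mon_degree_single)
  from Suc.hyps(1)[OF this] obtain "is" where
    "is": "length is = mon_degree m'" "set is = Poly_Mapping.keys m'" "var_monomial is = m'"
    by auto
  have "Poly_Mapping.keys m = insert i (Poly_Mapping.keys m')"
    unfolding m by (auto simp: in_keys_iff lookup_add lookup_single when_def split: if_splits)
  with "is" show ?case
    by (intro exI[of _ "i # is"]) (simp add: m var_monomial_def mon_degree_add)
qed

lemma prod_list_mp_var: "(\<Prod>i\<leftarrow>is. mp_var i) = Poly_Mapping.single (var_monomial is) 1"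
  by (induction "is") (auto simp: var_monomial_def mp_var_def mult_single)

lemma keys_in_mp_vars: "m \<in> Poly_Mapping.keys p \<Longrightarrow> Poly_Mapping.keys m \<subseteq> mp_vars p"
  by (auto simp: mp_vars_def)

text \<open>Every monomial of degree k comes from a word of length k over V. This overcounts, but a
  power with exponent k is all that the size bound asks for.\<close>

lemma card_keys_hom:
  assumes "hom_of_degree k p" "mp_vars p \<subseteq> V" "finite V"
  shows "card (Poly_Mapping.keys p) \<le> card V ^ k"
proof -
  let ?L = "{is. set is \<subseteq> V \<and> length is = k}"
  have "Poly_Mapping.keys p \<subseteq> var_monomial ` ?L"
  proof
    fix m assume m: "m \<in> Poly_Mapping.keys p"
    obtain "is" where "length is = mon_degree m" "set is = Poly_Mapping.keys m" "var_monomial is = m"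
      using var_monomial_surj by blast
    with m assms keys_in_mp_vars[OF m] show "m \<in> var_monomial ` ?L"
      by (auto simp: hom_of_degree_def)
  qed
  then have "card (Poly_Mapping.keys p) \<le> card ?L"
    using assms(3) by (intro surj_card_le finite_lists_length_eq)
  then show ?thesis
    using assms(3) by (simp add: card_lists_length_eq)
qed

text \<open>The pairs mirror the gates to be built: the coefficient becomes a scalar leaf and the
  word a list of input leaves.\<close>

lemma hom_poly_sum_monomials:
  fixes p :: "'a::field mpoly"
  assumes "hom_of_degree k p"
  obtains Ms :: "('a \<times> nat list) list" where
    "p = (\<Sum>(c, is)\<leftarrow>Ms. mp_const c * (\<Prod>i\<leftarrow>is. mp_var i))"
    "length Ms = card (Poly_Mapping.keys p)"
    "\<And>c is. (c, is) \<in> set Ms \<Longrightarrow> length is = k \<and> set is \<subseteq> mp_vars p"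
proof -
  obtain g where g: "\<And>m. length (g m) = mon_degree m" "\<And>m. set (g m) = Poly_Mapping.keys m"
    "\<And>m. var_monomial (g m) = m"
    using var_monomial_surj by metis
  obtain ms where ms: "set ms = Poly_Mapping.keys p" "distinct ms"
    using finite_distinct_list[of "Poly_Mapping.keys p"] by auto
  define Ms where "Ms = map (\<lambda>m. (Poly_Mapping.lookup p m, g m)) ms"
  have "p = (\<Sum>m\<leftarrow>ms. Poly_Mapping.single m (Poly_Mapping.lookup p m))"
    using poly_eq_sum_keys[of p] ms by (simp add: sum_list_distinct_conv_sum_set)
  also have "\<dots> = (\<Sum>(c, is)\<leftarrow>Ms. mp_const c * (\<Prod>i\<leftarrow>is. mp_var i))"
    unfolding Ms_def by (simp add: o_def prod_list_mp_var mp_const_def mult_single g)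
  finally show ?thesis
  proof (rule that)
    show "length Ms = card (Poly_Mapping.keys p)"
      using ms distinct_card[of ms] by (simp add: Ms_def)
    show "length is = k \<and> set is \<subseteq> mp_vars p" if "(c, is) \<in> set Ms" for c "is"
      using that assms ms by (auto simp: Ms_def g hom_of_degree_def dest: subsetD[OF keys_in_mp_vars])
  qed
qed

lemma mp_vars_add: "mp_vars (p + q) \<subseteq> mp_vars p \<union> mp_vars q"
  using Poly_Mapping.keys_add[of p q] by (auto simp: mp_vars_def)

lemma mp_vars_mult: "mp_vars (p * q) \<subseteq> mp_vars p \<union> mp_vars q"
proof
  fix i assume "i \<in> mp_vars (p * q)"
  then obtain m where m: "m \<in> Poly_Mapping.keys (p * q)" "i \<in> Poly_Mapping.keys m"
    by (auto simp: mp_vars_def)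
  with keys_mult[of p q] obtain u v where
    "m = u + v" "u \<in> Poly_Mapping.keys p" "v \<in> Poly_Mapping.keys q" by auto
  with m(2) Poly_Mapping.keys_add[of u v] show "i \<in> mp_vars p \<union> mp_vars q"
    by (auto simp: mp_vars_def)
qed

lemma mp_vars_formula_poly: "mp_vars (formula_poly \<phi>) \<subseteq> formula_vars \<phi>"
proof (induction \<phi>)
  case (FVar i)
  then show ?case by (simp add: mp_vars_def mp_var_def)
next
  case (FConst c)
  then show ?case by (simp add: mp_vars_def mp_const_def)
next
  case (FAdd \<phi>s)
  then show ?case
  proof (induction \<phi>s)
    case (Cons \<phi> \<phi>s)
    then show ?case
      using mp_vars_add[of "formula_poly \<phi>" "sum_list (map formula_poly \<phi>s)"] by fastforce
  qed (simp add: mp_vars_def)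
next
  case (FMul \<phi>s)
  then show ?case
  proof (induction \<phi>s)
    case (Cons \<phi> \<phi>s)
    then show ?case
      using mp_vars_mult[of "formula_poly \<phi>" "prod_list (map formula_poly \<phi>s)"] by fastforce
  qed (simp add: mp_vars_def)
qed


section \<open>Expanding homogeneous formulas\<close>

abbreviation formula_degree :: "'a::field formula \<Rightarrow> nat" where
  "formula_degree \<phi> \<equiv> total_degree (formula_poly \<phi>)"

text \<open>Zero is excluded because its \<open>total_degree\<close> is 0 by default, with which
  degrees would fail to add up over a product.\<close>

definition nonzero_homogeneous :: "'a::field formula \<Rightarrow> bool" where
  "nonzero_homogeneous \<phi> \<longleftrightarrow> homogeneous_formula \<phi> \<and> formula_poly \<phi> \<noteq> 0"

lemma homogeneous_formula_hom:
  "homogeneous_formula \<phi> \<Longrightarrow> hom_of_degree (formula_degree \<phi>) (formula_poly \<phi>)"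
  unfolding homogeneous_poly_total_degree[symmetric]
  by (cases \<phi>) (auto intro: hom_of_degree_imp_homogeneous hom_of_degree_mp_var hom_of_degree_mp_const)

lemma formula_size_pos: "formula_size \<phi> > 0"
  by (cases \<phi>) auto

text \<open>The summands of a homogeneous sum may have any degree: those of the wrong degree cancel.\<close>

definition live_summands :: "'a::field formula list \<Rightarrow> 'a formula list" where
  "live_summands \<phi>s = filter (\<lambda>\<psi>. formula_poly \<psi> \<noteq> 0 \<and>
     formula_degree \<psi> = formula_degree (FAdd \<phi>s)) \<phi>s"

text \<open>Compare coefficients. Both sides are homogeneous of the degree of the sum, so only
  monomials of that degree matter, and there a discarded summand, being 0 or of another degree, has
  coefficient 0.\<close>

lemma live_summands_poly:
  assumes "homogeneous_formula (FAdd \<phi>s)"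
  shows "(\<Sum>\<psi>\<leftarrow>live_summands \<phi>s. formula_poly \<psi>) = formula_poly (FAdd \<phi>s)" (is "?l = ?r")
proof (rule poly_mapping_eqI)
  fix m
  let ?k = "formula_degree (FAdd \<phi>s)"
  have r: "hom_of_degree ?k ?r"
    by (rule homogeneous_formula_hom[OF assms])
  have ch: "hom_of_degree (formula_degree \<psi>) (formula_poly \<psi>)" if "\<psi> \<in> set \<phi>s" for \<psi>
    using that assms by (auto intro: homogeneous_formula_hom)
  have l: "hom_of_degree ?k ?l"
    using ch by (intro hom_of_degree_sum_list) (force simp: live_summands_def)
  show "Poly_Mapping.lookup ?l m = Poly_Mapping.lookup ?r m"
  proof (cases "mon_degree m = ?k")
    case False
    with l r have "m \<notin> Poly_Mapping.keys ?l" "m \<notin> Poly_Mapping.keys ?r"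
      unfolding hom_of_degree_def by blast+
    then show ?thesis by (simp add: in_keys_iff)
  next
    case True
    have "Poly_Mapping.lookup (formula_poly \<psi>) m = 0"
      if "\<psi> \<in> set \<phi>s" "\<not> (formula_poly \<psi> \<noteq> 0 \<and> formula_degree \<psi> = ?k)" for \<psi>
    proof (cases "formula_poly \<psi> = 0")
      case False
      with that(2) True have "mon_degree m \<noteq> formula_degree \<psi>"
        by metis
      with ch[OF that(1)] have "m \<notin> Poly_Mapping.keys (formula_poly \<psi>)"
        unfolding hom_of_degree_def by blast
      then show ?thesis by (simp add: in_keys_iff)
    qed simp
    then have "(\<Sum>\<psi>\<leftarrow>live_summands \<phi>s. Poly_Mapping.lookup (formula_poly \<psi>) m)
        = (\<Sum>\<psi>\<leftarrow>\<phi>s. Poly_Mapping.lookup (formula_poly \<psi>) m)"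
      unfolding live_summands_def by (intro sum_list_map_filter) auto
    then show ?thesis
      by (simp add: lookup_sum_list)
  qed
qed

lemma live_summands_nonzero_homogeneous:
  "homogeneous_formula (FAdd \<phi>s) \<Longrightarrow> \<psi> \<in> set (live_summands \<phi>s) \<Longrightarrow> nonzero_homogeneous \<psi>"
  by (auto simp: live_summands_def nonzero_homogeneous_def)

text \<open>A product that is not 0 has no factor 0, and its degree is determined, so it must be the
  sum of the degrees of its homogeneous factors.\<close>

lemma nonzero_homogeneous_FMul:
  assumes "nonzero_homogeneous (FMul \<phi>s)"
  shows "\<And>\<psi>. \<psi> \<in> set \<phi>s \<Longrightarrow> nonzero_homogeneous \<psi>"
    and "(\<Sum>\<psi>\<leftarrow>\<phi>s. formula_degree \<psi>) = formula_degree (FMul \<phi>s)"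
proof -
  have nz: "(\<Prod>\<psi>\<leftarrow>\<phi>s. formula_poly \<psi>) \<noteq> 0"
    using assms by (simp add: nonzero_homogeneous_def)
  have "(\<Prod>\<psi>\<leftarrow>xs. formula_poly \<psi>) = 0" if "\<psi> \<in> set xs" "formula_poly \<psi> = 0" for \<psi> :: "'a formula" and xs
    using that by (induction xs) auto
  with nz assms show "\<And>\<psi>. \<psi> \<in> set \<phi>s \<Longrightarrow> nonzero_homogeneous \<psi>"
    by (auto simp: nonzero_homogeneous_def)
  have "hom_of_degree (\<Sum>\<psi>\<leftarrow>\<phi>s. formula_degree \<psi>) (\<Prod>\<psi>\<leftarrow>\<phi>s. formula_poly \<psi>)"
    using assms by (intro hom_of_degree_prod_list homogeneous_formula_hom)
      (auto simp: nonzero_homogeneous_def)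
  then show "(\<Sum>\<psi>\<leftarrow>\<phi>s. formula_degree \<psi>) = formula_degree (FMul \<phi>s)"
    using total_degree_hom[OF _ nz] by simp
qed

lemma formula_degree_leaf:
  "formula_degree (FVar i) \<le> 1" "formula_degree (FConst c) = 0"
  by (metis hom_of_degree_mp_var total_degree_hom total_degree_0 formula_poly.simps(1) le_refl zero_le,
      metis hom_of_degree_mp_const total_degree_hom total_degree_0 formula_poly.simps(2))

lemma live_summands_ex:
  assumes "nonzero_homogeneous (FAdd \<phi>s)"
  obtains \<psi> where "\<psi> \<in> set (live_summands \<phi>s)"
proof -
  have "live_summands \<phi>s \<noteq> []"
    using live_summands_poly[of \<phi>s] assms by (auto simp: nonzero_homogeneous_def)
  then show ?thesis
    using that[of "hd (live_summands \<phi>s)"] by simp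
qed

lemma live_summandsD:
  assumes "\<psi> \<in> set (live_summands \<phi>s)"
  shows "\<psi> \<in> set \<phi>s" "formula_poly \<psi> \<noteq> 0" "formula_degree \<psi> = formula_degree (FAdd \<phi>s)"
  using assms unfolding live_summands_def by auto

lemma product_depth_child:
  "\<psi> \<in> set \<phi>s \<Longrightarrow> product_depth \<psi> \<le> product_depth (FAdd \<phi>s)"
  "\<psi> \<in> set \<phi>s \<Longrightarrow> product_depth \<psi> < product_depth (FMul \<phi>s)"
  by (auto simp: less_Suc_eq_le)

text \<open>Serves to show that the size is at least 2 when the degree is, so that constants can be
  absorbed into powers of s.\<close>

lemma formula_degree_le_size:
  "nonzero_homogeneous \<phi> \<Longrightarrow> formula_degree \<phi> \<le> formula_size \<phi>"
proof (induction \<phi>)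
  case (FAdd \<phi>s)
  from live_summands_ex[OF FAdd.prems] obtain \<psi> where \<psi>: "\<psi> \<in> set (live_summands \<phi>s)" .
  have "nonzero_homogeneous \<psi>"
    using live_summands_nonzero_homogeneous[OF _ \<psi>] FAdd.prems by (simp add: nonzero_homogeneous_def)
  with FAdd.IH \<psi> have "formula_degree (FAdd \<phi>s) \<le> formula_size \<psi>"
    by (metis live_summandsD(1,3))
  also have "\<dots> \<le> (\<Sum>\<psi>\<leftarrow>\<phi>s. formula_size \<psi>)"
    using live_summandsD(1)[OF \<psi>] by (intro member_le_sum_list) auto
  finally show ?case by simp
next
  case (FMul \<phi>s)
  have "formula_degree (FMul \<phi>s) = (\<Sum>\<psi>\<leftarrow>\<phi>s. formula_degree \<psi>)"
    by (rule nonzero_homogeneous_FMul(2)[OF FMul.prems, symmetric])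
  also have "\<dots> \<le> (\<Sum>\<psi>\<leftarrow>\<phi>s. formula_size \<psi>)"
    using FMul nonzero_homogeneous_FMul(1)[OF FMul.prems] by (intro sum_list_mono) auto
  finally show ?case by simp
qed (simp_all add: formula_degree_leaf del: formula_poly.simps One_nat_def)

text \<open>Without product gates, live summands lead down to a leaf of the same degree. Hence
  \<Delta> is at least 1 whenever the degree is at least 2.\<close>

lemma formula_degree_depth_0:
  "nonzero_homogeneous \<phi> \<Longrightarrow> product_depth \<phi> = 0 \<Longrightarrow> formula_degree \<phi> \<le> 1"
proof (induction \<phi>)
  case (FAdd \<phi>s)
  from live_summands_ex[OF FAdd.prems(1)] obtain \<psi> where \<psi>: "\<psi> \<in> set (live_summands \<phi>s)" .
  have "nonzero_homogeneous \<psi>"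
    using live_summands_nonzero_homogeneous[OF _ \<psi>] FAdd.prems by (simp add: nonzero_homogeneous_def)
  moreover have "product_depth \<psi> = 0"
    using product_depth_child(1)[OF live_summandsD(1)[OF \<psi>]] FAdd.prems(2) by linarith
  ultimately show ?case
    by (metis FAdd.IH live_summandsD(1,3) \<psi>)
qed (simp_all add: formula_degree_leaf del: formula_poly.simps One_nat_def)

text \<open>Allows monomials to be counted in powers of s, whatever the ambient number of variables
  is.\<close>

lemma card_formula_vars: "finite (formula_vars \<phi>) \<and> card (formula_vars \<phi>) \<le> formula_size \<phi>"
proof -
  have "finite (\<Union>\<phi>\<in>set \<phi>s. formula_vars \<phi>) \<and>
      card (\<Union>\<phi>\<in>set \<phi>s. formula_vars \<phi>) \<le> (\<Sum>\<phi>\<leftarrow>\<phi>s. formula_size \<phi>)"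
    if "\<forall>\<phi>\<in>set \<phi>s. finite (formula_vars \<phi>) \<and> card (formula_vars \<phi>) \<le> formula_size \<phi>"
    for \<phi>s :: "'a formula list"
    using that
  proof (induction \<phi>s)
    case (Cons \<phi> \<phi>s)
    then show ?case
      using card_Un_le[of "formula_vars \<phi>" "\<Union>\<phi>\<in>set \<phi>s. formula_vars \<phi>"] by auto
  qed simp
  then show ?thesis
    by (induction \<phi>) (simp_all add: le_SucI)
qed


subsection \<open>Expansions\<close>

text \<open>What a factor inherits from the factor that it came from. Size is tracked in
  \<open>refinement\<close> instead, as a sum over the whole term; that sum also bounds the number
  of factors.\<close>

definition refined_by :: "'a::field formula \<Rightarrow> 'a formula \<Rightarrow> bool" where
  "refined_by \<phi> \<psi> \<longleftrightarrow> formula_degree \<psi> \<le> formula_degree \<phi> \<and>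
     formula_vars \<psi> \<subseteq> formula_vars \<phi> \<and> product_depth \<psi> \<le> product_depth \<phi>"

text \<open>Both a term of an expansion and the expanded formula are products, given by the lists of
  their factors.\<close>

definition refinement :: "'a::field formula list \<Rightarrow> 'a formula list \<Rightarrow> bool" where
  "refinement \<phi>s T \<longleftrightarrow> (\<Sum>\<psi>\<leftarrow>T. formula_size \<psi>) \<le> (\<Sum>\<phi>\<leftarrow>\<phi>s. formula_size \<phi>) \<and>
     (\<Sum>\<psi>\<leftarrow>T. formula_degree \<psi>) = (\<Sum>\<phi>\<leftarrow>\<phi>s. formula_degree \<phi>) \<and>
     (\<forall>\<psi>\<in>set T. nonzero_homogeneous \<psi> \<and> (\<exists>\<phi>\<in>set \<phi>s. refined_by \<phi> \<psi>))"

definition expansion :: "'a::field formula list \<Rightarrow> 'a formula list list \<Rightarrow> bool" where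
  "expansion \<phi>s Ts \<longleftrightarrow> (\<Prod>\<phi>\<leftarrow>\<phi>s. formula_poly \<phi>) = (\<Sum>T\<leftarrow>Ts. \<Prod>\<psi>\<leftarrow>T. formula_poly \<psi>) \<and>
     (\<forall>T\<in>set Ts. refinement \<phi>s T)"

lemma refined_by_refl: "refined_by \<phi> \<phi>"
  by (simp add: refined_by_def)

lemma refined_by_trans: "refined_by \<phi> \<psi> \<Longrightarrow> refined_by \<psi> \<chi> \<Longrightarrow> refined_by \<phi> \<chi>"
  by (auto simp: refined_by_def)

lemma refinement_append:
  assumes "refinement \<phi>s T" "refinement \<chi>s U"
  shows "refinement (\<phi>s @ \<chi>s) (T @ U)"
  using assms unfolding refinement_def by (simp add: add_mono) blast

lemma refinement_trans:
  assumes "refinement \<phi>s T" "refinement T U"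
  shows "refinement \<phi>s U"
  using assms unfolding refinement_def by (metis order_trans refined_by_trans)

lemma expansion_refl: "(\<And>\<phi>. \<phi> \<in> set \<phi>s \<Longrightarrow> nonzero_homogeneous \<phi>) \<Longrightarrow> expansion \<phi>s [\<phi>s]"
  by (auto simp: expansion_def refinement_def intro: refined_by_refl)

text \<open>Distributivity; the numbers of terms multiply. Expanding each term further, as in the
  next lemma, adds them.\<close>

lemma expansion_append:
  assumes "expansion \<phi>s Ts" "expansion \<chi>s Us"
  shows "expansion (\<phi>s @ \<chi>s) [T @ U. T \<leftarrow> Ts, U \<leftarrow> Us]"
proof -
  have "(\<Sum>T\<leftarrow>Ts. \<Prod>\<psi>\<leftarrow>T. formula_poly \<psi>) * (\<Sum>T\<leftarrow>Us. \<Prod>\<psi>\<leftarrow>T. formula_poly \<psi>)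
    = (\<Sum>T\<leftarrow>[T @ U. T \<leftarrow> Ts, U \<leftarrow> Us]. \<Prod>\<psi>\<leftarrow>T. formula_poly \<psi>)"
  proof (induction Ts)
    case (Cons T Ts)
    then show ?case
      by (simp add: distrib_right o_def sum_list_const_mult)
  qed simp
  with assms show ?thesis
    unfolding expansion_def by (auto intro: refinement_append)
qed

lemma expansion_concat:
  assumes "expansion \<phi>s Ts" "\<And>T. T \<in> set Ts \<Longrightarrow> expansion T (G T)"
  shows "expansion \<phi>s (concat (map G Ts))"
proof -
  have "(\<Sum>T\<leftarrow>Ts. \<Prod>\<psi>\<leftarrow>T. formula_poly \<psi>) = (\<Sum>T\<leftarrow>concat (map G Ts). \<Prod>\<psi>\<leftarrow>T. formula_poly \<psi>)"
    using assms(2) unfolding expansion_def by (induction Ts) auto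
  with assms show ?thesis
    unfolding expansion_def by (auto intro: refinement_trans)
qed

lemma expansion_FAdd:
  assumes "nonzero_homogeneous (FAdd \<phi>s)"
    and F: "\<And>\<psi>. \<psi> \<in> set (live_summands \<phi>s) \<Longrightarrow> expansion [\<psi>] (F \<psi>)"
  shows "expansion [FAdd \<phi>s] (concat (map F (live_summands \<phi>s)))"
proof -
  have hom: "homogeneous_formula (FAdd \<phi>s)"
    using assms(1) by (simp add: nonzero_homogeneous_def)
  have "expansion [FAdd \<phi>s] (map (\<lambda>\<psi>. [\<psi>]) (live_summands \<phi>s))"
    unfolding expansion_def refinement_def
  proof (intro conjI ballI)
    fix T assume "T \<in> set (map (\<lambda>\<psi>. [\<psi>]) (live_summands \<phi>s))"
    then obtain \<psi> where T: "T = [\<psi>]" and \<psi>: "\<psi> \<in> set (live_summands \<phi>s)"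
      by auto
    note D = live_summandsD[OF \<psi>]
    show "(\<Sum>\<psi>\<leftarrow>T. formula_degree \<psi>) = (\<Sum>\<phi>\<leftarrow>[FAdd \<phi>s]. formula_degree \<phi>)"
      using D(3) by (simp add: T)
    show "(\<Sum>\<psi>\<leftarrow>T. formula_size \<psi>) \<le> (\<Sum>\<phi>\<leftarrow>[FAdd \<phi>s]. formula_size \<phi>)"
      using member_le_sum_list[of "formula_size \<psi>" "map formula_size \<phi>s"] D(1) by (simp add: T)
    fix \<chi> assume "\<chi> \<in> set T"
    then have \<chi>: "\<chi> = \<psi>" by (simp add: T)
    show "nonzero_homogeneous \<chi>"
      using live_summands_nonzero_homogeneous[OF hom \<psi>] by (simp add: \<chi>)
    have "refined_by (FAdd \<phi>s) \<psi>"
      using D(1,3) product_depth_child(1)[OF D(1)] unfolding refined_by_def by auto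
    then show "\<exists>\<phi>\<in>set [FAdd \<phi>s]. refined_by \<phi> \<chi>"
      by (simp add: \<chi>)
  qed (use live_summands_poly[OF hom] in \<open>simp add: o_def\<close>)
  then have "expansion [FAdd \<phi>s] (concat (map (\<lambda>T. F (hd T)) (map (\<lambda>\<psi>. [\<psi>]) (live_summands \<phi>s))))"
    using F by (intro expansion_concat) auto
  then show ?thesis
    by (simp add: o_def)
qed

lemma expansion_FMul:
  assumes "nonzero_homogeneous (FMul \<phi>s)" "expansion \<phi>s Ts"
  shows "expansion [FMul \<phi>s] Ts"
proof -
  note M = nonzero_homogeneous_FMul[OF assms(1)]
  have "refined_by (FMul \<phi>s) \<psi>" if "\<psi> \<in> set \<phi>s" for \<psi>
    unfolding refined_by_def
    using that product_depth_child(2)[OF that]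
      member_le_sum_list[of "formula_degree \<psi>" "map formula_degree \<phi>s"] M(2) by auto
  then have "expansion [FMul \<phi>s] [\<phi>s]"
    using M unfolding expansion_def refinement_def by auto
  from expansion_concat[OF this, of "\<lambda>_. Ts"] assms(2) show ?thesis
    by auto
qed

text \<open>Iterated distributivity. The bounds b are real because they will be powers with exponent
  \<open>formula_degree \<phi> / \<tau>\<close>.\<close>

lemma expansion_list:
  fixes b :: "'a::field formula \<Rightarrow> real"
  assumes "\<And>\<phi>. \<phi> \<in> set \<phi>s \<Longrightarrow> \<exists>Ts. expansion [\<phi>] Ts \<and> real (length Ts) \<le> b \<phi> \<and>
    (\<forall>T\<in>set Ts. \<forall>\<psi>\<in>set T. Q \<psi>)"
  shows "\<exists>Ts. expansion \<phi>s Ts \<and> real (length Ts) \<le> (\<Prod>\<phi>\<leftarrow>\<phi>s. b \<phi>) \<and> (\<forall>T\<in>set Ts. \<forall>\<psi>\<in>set T. Q \<psi>)"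
  using assms
proof (induction \<phi>s)
  case Nil
  show ?case
    using expansion_refl[of "[]"] by (intro exI[of _ "[[]]"]) simp
next
  case (Cons \<phi> \<phi>s)
  obtain Ts where Ts: "expansion [\<phi>] Ts" "real (length Ts) \<le> b \<phi>" "\<forall>T\<in>set Ts. \<forall>\<psi>\<in>set T. Q \<psi>"
    using Cons.prems[of \<phi>] by auto
  obtain Us where Us: "expansion \<phi>s Us" "real (length Us) \<le> (\<Prod>\<phi>\<leftarrow>\<phi>s. b \<phi>)"
    "\<forall>T\<in>set Us. \<forall>\<psi>\<in>set T. Q \<psi>"
    using Cons.IH[OF Cons.prems] by auto
  have len: "length [T @ U. T \<leftarrow> Ts, U \<leftarrow> Us] = length Ts * length Us"
    by (simp add: length_concat o_def sum_list_triv)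
  have "real (length Ts) * real (length Us) \<le> b \<phi> * (\<Prod>\<phi>\<leftarrow>\<phi>s. b \<phi>)"
    using Ts(2) Us(2) by (intro mult_mono) (auto intro: order_trans[OF of_nat_0_le_iff])
  then show ?case
  proof (intro exI[of _ "[T @ U. T \<leftarrow> Ts, U \<leftarrow> Us]"] conjI)
    show "expansion (\<phi> # \<phi>s) [T @ U. T \<leftarrow> Ts, U \<leftarrow> Us]"
      using expansion_append[OF Ts(1) Us(1)] by simp
    show "\<forall>T\<in>set [T @ U. T \<leftarrow> Ts, U \<leftarrow> Us]. \<forall>\<psi>\<in>set T. Q \<psi>"
      using Ts(3) Us(3) by auto
  qed (simp add: len)
qed


subsection \<open>Expanding all factors of large degree\<close>

text \<open>Superadditivity of the power function: split off one factor,
  \<open>x powr e = x * x powr (e - 1)\<close>, and enlarge the base of the remaining monotone power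
  to the whole sum. This is why sum gates do not spoil the count of terms.\<close>

lemma sum_list_powr_le:
  fixes xs :: "real list"
  assumes "\<And>x. x \<in> set xs \<Longrightarrow> 0 \<le> x" "1 \<le> e"
  shows "(\<Sum>x\<leftarrow>xs. x powr e) \<le> sum_list xs powr e"
  using assms(1)
proof (induction xs)
  case (Cons x xs)
  let ?S = "sum_list xs"
  have nn: "0 \<le> x" "0 \<le> ?S"
    using Cons.prems by (auto intro: sum_list_nonneg)
  have eq: "y powr e = y * y powr (e - 1)" if "0 \<le> y" for y :: real
    using that by (cases "y = 0") (auto simp: powr_mult_base)
  have "x powr e + ?S powr e = x * x powr (e - 1) + ?S * ?S powr (e - 1)"
    using nn by (simp add: eq[symmetric])
  also have "\<dots> \<le> x * (x + ?S) powr (e - 1) + ?S * (x + ?S) powr (e - 1)"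
    using nn assms(2) by (intro add_mono mult_left_mono powr_mono2) auto
  also have "\<dots> = (x + ?S) powr e"
    using nn by (simp add: eq[of "x + ?S"] distrib_right)
  finally show ?case
    using Cons by auto
qed simp

lemma prod_list_powr:
  fixes x :: real
  assumes "x > 0"
  shows "(\<Prod>y\<leftarrow>ys. x powr g y) = x powr (\<Sum>y\<leftarrow>ys. g y)"
  using assms by (induction ys) (auto simp: powr_add)

lemma length_concat_map: "length (concat (map F xs)) = (\<Sum>x\<leftarrow>xs. length (F x))"
  by (simp add: length_concat o_def)

lemma sum_list_filter_le_nonneg:
  fixes f :: "'b \<Rightarrow> real"
  assumes "\<And>x. x \<in> set xs \<Longrightarrow> 0 \<le> f x"
  shows "(\<Sum>x\<leftarrow>filter P xs. f x) \<le> (\<Sum>x\<leftarrow>xs. f x)"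
  using assms by (induction xs) (auto intro: add_increasing)

text \<open>Formulas of degree at most \<tau> stay whole. Above \<tau>, all live summands of a sum
  share its degree, hence the exponent, and superadditivity absorbs the summation; at a product the
  exponents of the children add up. Since \<tau> is at least 1, no leaf exceeds it, so a formula
  above \<tau> is always opened at some product gate, which accounts for the drop in
  product-depth.\<close>

lemma threshold_expansion:
  fixes \<tau> :: nat and \<phi> :: "'a::field formula"
  assumes "\<tau> \<ge> 1" "nonzero_homogeneous \<phi>"
  shows "\<exists>Ts. expansion [\<phi>] Ts \<and>
    real (length Ts) \<le> real (formula_size \<phi>) powr (real (formula_degree \<phi>) / real \<tau>) \<and>
    (\<forall>T\<in>set Ts. \<forall>\<psi>\<in>set T. formula_degree \<psi> \<le> \<tau> \<and>
      (\<tau> < formula_degree \<phi> \<longrightarrow> product_depth \<psi> < product_depth \<phi>))"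
  using assms(2)
proof (induction \<phi>)
  case (FVar i)
  have "formula_degree (FVar i :: 'a formula) \<le> 1"
    by (rule formula_degree_leaf(1))
  with FVar show ?case
    using assms(1) expansion_refl[of "[FVar i :: 'a formula]"]
    by (intro exI[of _ "[[FVar i]]"]) (auto simp del: formula_poly.simps)
next
  case (FConst c)
  then show ?case
    using assms(1) formula_degree_leaf(2)[of c] expansion_refl[of "[FConst c]"]
    by (intro exI[of _ "[[FConst c]]"]) (auto simp del: formula_poly.simps)
next
  case (FAdd \<phi>s)
  let ?\<phi> = "FAdd \<phi>s" let ?k = "formula_degree (FAdd \<phi>s)"
  have hom: "homogeneous_formula ?\<phi>"
    using FAdd.prems by (simp add: nonzero_homogeneous_def)
  show ?case
  proof (cases "?k \<le> \<tau>")
    case True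
    then show ?thesis
      using expansion_refl[of "[?\<phi>]"] FAdd.prems formula_size_pos[of ?\<phi>]
      by (intro exI[of _ "[[?\<phi>]]"]) (auto simp del: formula_poly.simps formula_size.simps intro: ge_one_powr_ge_zero)
  next
    case False
    \<comment> \<open>A live summand has the degree \<open>?k\<close> of the sum and so exceeds
      \<tau> too: the induction hypothesis yields the common exponent and also the strict drop in
      product-depth.\<close>
    have "\<exists>Ts. expansion [\<psi>] Ts \<and>
        real (length Ts) \<le> real (formula_size \<psi>) powr (real ?k / real \<tau>) \<and>
        (\<forall>T\<in>set Ts. \<forall>\<chi>\<in>set T. formula_degree \<chi> \<le> \<tau> \<and> product_depth \<chi> < product_depth ?\<phi>)"
      if \<psi>: "\<psi> \<in> set (live_summands \<phi>s)" for \<psi>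
    proof -
      note D = live_summandsD[OF \<psi>]
      from FAdd.IH[OF D(1) live_summands_nonzero_homogeneous[OF hom \<psi>]] False
      show ?thesis
        unfolding D(3) using product_depth_child(1)[OF D(1)] by (meson less_le_trans not_less)
    qed
    then obtain F where F: "\<And>\<psi>. \<psi> \<in> set (live_summands \<phi>s) \<Longrightarrow> expansion [\<psi>] (F \<psi>) \<and>
        real (length (F \<psi>)) \<le> real (formula_size \<psi>) powr (real ?k / real \<tau>) \<and>
        (\<forall>T\<in>set (F \<psi>). \<forall>\<chi>\<in>set T. formula_degree \<chi> \<le> \<tau> \<and> product_depth \<chi> < product_depth ?\<phi>)"
      by metis
    let ?Ts = "concat (map F (live_summands \<phi>s))"
    have "real (length ?Ts) = (\<Sum>\<psi>\<leftarrow>live_summands \<phi>s. real (length (F \<psi>)))"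
      by (simp add: length_concat_map o_def flip: sum_list_of_nat)
    also have "\<dots> \<le> (\<Sum>\<psi>\<leftarrow>live_summands \<phi>s. real (formula_size \<psi>) powr (real ?k / real \<tau>))"
      using F by (intro sum_list_mono) blast
    also have "\<dots> \<le> (\<Sum>\<psi>\<leftarrow>\<phi>s. real (formula_size \<psi>) powr (real ?k / real \<tau>))"
      unfolding live_summands_def by (rule sum_list_filter_le_nonneg) auto
    also have "\<dots> = (\<Sum>x\<leftarrow>map (\<lambda>\<psi>. real (formula_size \<psi>)) \<phi>s. x powr (real ?k / real \<tau>))"
      by (simp add: o_def)
    \<comment> \<open>The exponent is at least 1 because \<open>?k\<close> exceeds \<tau>.\<close>
    also have "\<dots> \<le> (\<Sum>\<psi>\<leftarrow>\<phi>s. real (formula_size \<psi>)) powr (real ?k / real \<tau>)"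
      using False assms(1) by (intro sum_list_powr_le) (auto simp: field_simps)
    also have "\<dots> \<le> real (formula_size ?\<phi>) powr (real ?k / real \<tau>)"
    proof (intro powr_mono2)
      show "0 \<le> (\<Sum>\<psi>\<leftarrow>\<phi>s. real (formula_size \<psi>))"
        by (intro sum_list_nonneg) auto
      show "(\<Sum>\<psi>\<leftarrow>\<phi>s. real (formula_size \<psi>)) \<le> real (formula_size ?\<phi>)"
        by (simp add: o_def flip: sum_list_of_nat)
    qed simp
    finally show ?thesis
      using F expansion_FAdd[OF FAdd.prems, of F] by (intro exI[of _ ?Ts]) auto
  qed
next
  case (FMul \<phi>s)
  let ?\<phi> = "FMul \<phi>s" let ?k = "formula_degree (FMul \<phi>s)" let ?S = "real (formula_size (FMul \<phi>s))"
  note M = nonzero_homogeneous_FMul[OF FMul.prems]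
  show ?case
  proof (cases "?k \<le> \<tau>")
    case True
    then show ?thesis
      using expansion_refl[of "[?\<phi>]"] FMul.prems formula_size_pos[of ?\<phi>]
      by (intro exI[of _ "[[?\<phi>]]"]) (auto simp del: formula_poly.simps formula_size.simps intro: ge_one_powr_ge_zero)
  next
    case False
    \<comment> \<open>The bounds of the children are weakened to the common base \<open>?S\<close>,
      so that their product is a single power whose exponents add.\<close>
    have "\<exists>Ts. expansion [\<psi>] Ts \<and> real (length Ts) \<le> ?S powr (real (formula_degree \<psi>) / real \<tau>) \<and>
        (\<forall>T\<in>set Ts. \<forall>\<chi>\<in>set T. formula_degree \<chi> \<le> \<tau>)" if \<psi>: "\<psi> \<in> set \<phi>s" for \<psi>
    proof -
      have "formula_size \<psi> \<le> formula_size ?\<phi>"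
        using member_le_sum_list[of "formula_size \<psi>" "map formula_size \<phi>s"] \<psi> by simp
      then have "real (formula_size \<psi>) powr (real (formula_degree \<psi>) / real \<tau>)
          \<le> ?S powr (real (formula_degree \<psi>) / real \<tau>)"
        by (intro powr_mono2) auto
      with FMul.IH[OF \<psi> M(1)[OF \<psi>]] show ?thesis
        by (meson order_trans)
    qed
    from expansion_list[of \<phi>s "\<lambda>\<psi>. ?S powr (real (formula_degree \<psi>) / real \<tau>)" "\<lambda>\<chi>. formula_degree \<chi> \<le> \<tau>", OF this]
    obtain Ts where Ts: "expansion \<phi>s Ts"
      "real (length Ts) \<le> (\<Prod>\<psi>\<leftarrow>\<phi>s. ?S powr (real (formula_degree \<psi>) / real \<tau>))"
      "\<forall>T\<in>set Ts. \<forall>\<chi>\<in>set T. formula_degree \<chi> \<le> \<tau>"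
      by blast
    have "(\<Sum>\<psi>\<leftarrow>\<phi>s. real (formula_degree \<psi>) / real \<tau>) = real (\<Sum>\<psi>\<leftarrow>\<phi>s. formula_degree \<psi>) / real \<tau>"
      by (induction \<phi>s) (auto simp: add_divide_distrib)
    then have "(\<Prod>\<psi>\<leftarrow>\<phi>s. ?S powr (real (formula_degree \<psi>) / real \<tau>)) = ?S powr (real ?k / real \<tau>)"
      using formula_size_pos[of ?\<phi>] M(2) by (subst prod_list_powr) auto
    \<comment> \<open>A child of degree at most \<tau> is kept whole and loses no depth itself; the
      strict drop is the one from the product gate to its children.\<close>
    moreover have "product_depth \<chi> < product_depth ?\<phi>" if "T \<in> set Ts" "\<chi> \<in> set T" for T \<chi>
    proof -
      from Ts(1) that obtain \<psi> where "\<psi> \<in> set \<phi>s" "refined_by \<psi> \<chi>"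
        unfolding expansion_def refinement_def by blast
      then show ?thesis
        using product_depth_child(2)[of \<psi> \<phi>s] unfolding refined_by_def by linarith
    qed
    ultimately show ?thesis
      using Ts expansion_FMul[OF FMul.prems Ts(1)] by (intro exI[of _ Ts]) auto
  qed
qed


subsection \<open>Expanding along a heavy path\<close>

definition nonconst_count :: "'a::field formula list \<Rightarrow> nat" where
  "nonconst_count T = length (filter (\<lambda>\<psi>. formula_degree \<psi> > 0) T)"

lemma nonconst_count_append [simp]: "nonconst_count (T @ U) = nonconst_count T + nonconst_count U"
  by (simp add: nonconst_count_def)

lemma sum_degree_le_nonconst_count:
  assumes "\<And>\<psi>. \<psi> \<in> set T \<Longrightarrow> formula_degree \<psi> \<le> K"
  shows "(\<Sum>\<psi>\<leftarrow>T. formula_degree \<psi>) \<le> nonconst_count T * K"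
  using assms by (induction T) (auto simp: nonconst_count_def add_mono)

text \<open>Going from a product gate to its child of largest degree divides the degree by at most the
  number of non-constant factors. Hence if the degree exceeds \<open>r ^ D\<close>, some product gate on this
  path has at least \<open>r\<close> non-constant factors.\<close>

lemma heavy_path_expansion:
  fixes r :: real and \<phi> :: "'a::field formula"
  assumes "nonzero_homogeneous \<phi>" "product_depth \<phi> \<le> D" "r \<ge> 1" "r ^ D < real (formula_degree \<phi>)"
  shows "\<exists>Ts. expansion [\<phi>] Ts \<and> length Ts \<le> formula_size \<phi> \<and>
    (\<forall>T\<in>set Ts. r \<le> real (nonconst_count T))"
  using assms(1,2,4)
proof (induction \<phi> arbitrary: D)
  case (FVar i)
  \<comment> \<open>As r is at least 1, the threshold never falls below 1, the largest degree of a
    leaf: the path cannot run into a leaf before a suitable product gate is met.\<close>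
  have "1 \<le> r ^ D" using assms(3) by simp
  with FVar.prems(3) have "\<not> formula_degree (FVar i :: 'a formula) \<le> 1"
    by linarith
  with formula_degree_leaf(1) show ?case by blast
next
  case (FConst c)
  have "0 \<le> r ^ D" using assms(3) by simp
  with FConst.prems(3) have False
    unfolding formula_degree_leaf(2) by linarith
  then show ?case ..
next
  case (FAdd \<phi>s)
  have hom: "homogeneous_formula (FAdd \<phi>s)"
    using FAdd.prems by (simp add: nonzero_homogeneous_def)
  have "\<exists>Ts. expansion [\<psi>] Ts \<and> length Ts \<le> formula_size \<psi> \<and>
    (\<forall>T\<in>set Ts. r \<le> real (nonconst_count T))" if \<psi>: "\<psi> \<in> set (live_summands \<phi>s)" for \<psi>
  proof -
    note D = live_summandsD[OF \<psi>]
    show ?thesis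
    proof (rule FAdd.IH[OF D(1) live_summands_nonzero_homogeneous[OF hom \<psi>]])
      show "product_depth \<psi> \<le> D"
        using product_depth_child(1)[OF D(1)] FAdd.prems(2) by linarith
      show "r ^ D < real (formula_degree \<psi>)"
        unfolding D(3) by (rule FAdd.prems(3))
    qed
  qed
  then obtain F where F: "\<And>\<psi>. \<psi> \<in> set (live_summands \<phi>s) \<Longrightarrow> expansion [\<psi>] (F \<psi>) \<and>
      length (F \<psi>) \<le> formula_size \<psi> \<and> (\<forall>T\<in>set (F \<psi>). r \<le> real (nonconst_count T))"
    by metis
  let ?Ts = "concat (map F (live_summands \<phi>s))"
  have "length ?Ts \<le> (\<Sum>\<psi>\<leftarrow>live_summands \<phi>s. formula_size \<psi>)"
    unfolding length_concat_map using F by (intro sum_list_mono) blast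
  also have "\<dots> \<le> (\<Sum>\<psi>\<leftarrow>\<phi>s. formula_size \<psi>)"
    unfolding live_summands_def by (rule sum_list_filter_le_nat)
  finally show ?case
    using F expansion_FAdd[OF FAdd.prems(1), of F] by (intro exI[of _ ?Ts]) auto
next
  case (FMul \<phi>s)
  note M = nonzero_homogeneous_FMul[OF FMul.prems(1)]
  show ?case
  proof (cases "r \<le> real (nonconst_count \<phi>s)")
    case True
    then show ?thesis
      using expansion_FMul[OF FMul.prems(1) expansion_refl[OF M(1)]]
      by (intro exI[of _ "[\<phi>s]"]) auto
  next
    case False
    have D: "D > 0" using FMul.prems(2) by simp
    have "0 \<le> r ^ D" using assms(3) by simp
    with FMul.prems(3) M(2) have "\<phi>s \<noteq> []"
      by (cases \<phi>s) auto
    define K where "K = Max (set (map formula_degree \<phi>s))"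
    have "K \<in> set (map formula_degree \<phi>s)"
      unfolding K_def using \<open>\<phi>s \<noteq> []\<close> by (intro Max_in) auto
    then obtain \<psi> where \<psi>: "\<psi> \<in> set \<phi>s" "formula_degree \<psi> = K"
      by auto
    \<comment> \<open>There are fewer than r non-constant factors here, so the largest degree K
      exceeds \<open>r ^ D / r\<close>, which is the induction hypothesis for D - 1.\<close>
    have "formula_degree (FMul \<phi>s) \<le> nonconst_count \<phi>s * K"
      unfolding M(2)[symmetric] by (rule sum_degree_le_nonconst_count) (auto simp: K_def)
    then have "r ^ D < real (nonconst_count \<phi>s) * real K"
      using FMul.prems(3) by (metis of_nat_le_iff of_nat_mult less_le_trans)
    also have "\<dots> \<le> r * real K"
      using False by (intro mult_right_mono) auto
    finally have K: "r ^ (D - 1) < real K"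
      using D assms(3) by (cases D) auto
    have "product_depth \<psi> \<le> D - 1"
      using product_depth_child(2)[OF \<psi>(1)] FMul.prems(2) by linarith
    from FMul.IH[OF \<psi>(1) M(1)[OF \<psi>(1)] this] K \<psi>(2)
    obtain Ts where Ts: "expansion [\<psi>] Ts" "length Ts \<le> formula_size \<psi>"
      "\<forall>T\<in>set Ts. r \<le> real (nonconst_count T)" by auto
    from split_list[OF \<psi>(1)] obtain xs ys where \<phi>s: "\<phi>s = xs @ \<psi> # ys"
      by blast
    \<comment> \<open>The siblings of the heavy child stay whole, so the number of terms is that of
      the child alone.\<close>
    have "expansion xs [xs]" "expansion ys [ys]"
      using M(1) by (auto simp: \<phi>s intro: expansion_refl)
    from expansion_append[OF this(1) expansion_append[OF Ts(1) this(2)]]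
    have E: "expansion (FMul \<phi>s # []) (map (\<lambda>T. xs @ T @ ys) Ts)"
      by (intro expansion_FMul[OF FMul.prems(1)]) (simp add: \<phi>s o_def concat_map_singleton)
    have "formula_size \<psi> \<le> formula_size (FMul \<phi>s)"
      by (simp add: \<phi>s)
    then show ?thesis
      using E Ts by (intro exI[of _ "map (\<lambda>T. xs @ T @ ys) Ts"]) auto
  qed
qed

section \<open>Raising the number of non-constant factors of a term\<close>

definition heavy_count :: "real \<Rightarrow> 'a::field formula list \<Rightarrow> nat" where
  "heavy_count H T = length (filter (\<lambda>\<psi>. H < real (formula_degree \<psi>)) T)"

text \<open>Each opened heavy factor yields r non-constant factors and multiplies the number of
  terms by at most s. The quota q stops this early: a term may have many more than
  \<open>d / \<tau>\<close> heavy factors, and opening them all could cost too much.\<close>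

lemma heavy_expansion:
  fixes r :: real
  assumes "\<And>\<psi>. \<psi> \<in> set T \<Longrightarrow> nonzero_homogeneous \<psi>"
    and "\<And>\<psi>. \<psi> \<in> set T \<Longrightarrow> product_depth \<psi> \<le> D"
    and "\<And>\<psi>. \<psi> \<in> set T \<Longrightarrow> formula_size \<psi> \<le> s"
    and "r \<ge> 1" "q \<le> heavy_count (r ^ D) T"
  shows "\<exists>Ts. expansion T Ts \<and> length Ts \<le> s ^ q \<and> (\<forall>U\<in>set Ts. real q * r \<le> real (nonconst_count U))"
  using assms(1-3,5)
proof (induction T arbitrary: q)
  case Nil
  then show ?case
    using expansion_refl[of "[]"] by (intro exI[of _ "[[]]"]) (auto simp: heavy_count_def)
next
  case (Cons \<psi> T)
  consider "q = 0" | "q > 0" "r ^ D < real (formula_degree \<psi>)" | "q > 0" "\<not> r ^ D < real (formula_degree \<psi>)"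
    by blast
  then show ?case
  proof cases
    case 1
    then show ?thesis
      using expansion_refl[of "\<psi> # T"] Cons.prems(1) by (intro exI[of _ "[\<psi> # T]"]) auto
  next
    case 2
    then have "q - 1 \<le> heavy_count (r ^ D) T"
      using Cons.prems(4) by (simp add: heavy_count_def)
    with Cons.IH[of "q - 1"] Cons.prems obtain Us where Us: "expansion T Us" "length Us \<le> s ^ (q - 1)"
      "\<forall>U\<in>set Us. real (q - 1) * r \<le> real (nonconst_count U)"
      by auto
    obtain Ts where Ts: "expansion [\<psi>] Ts" "length Ts \<le> formula_size \<psi>"
      "\<forall>T\<in>set Ts. r \<le> real (nonconst_count T)"
      using heavy_path_expansion[of \<psi> D r] Cons.prems(1,2) assms(4) 2(2) by auto
    let ?Vs = "[V @ U. V \<leftarrow> Ts, U \<leftarrow> Us]"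
    have "length ?Vs = length Ts * length Us"
      by (simp add: length_concat o_def sum_list_triv)
    also have "\<dots> \<le> s * s ^ (q - 1)"
      using Ts(2) Us(2) Cons.prems(3)[of \<psi>] by (intro mult_mono) auto
    also have "\<dots> = s ^ q"
      using 2(1) by (cases q) auto
    finally have "length ?Vs \<le> s ^ q" .
    moreover have "real q * r \<le> real (nonconst_count (V @ U))" if "V \<in> set Ts" "U \<in> set Us" for V U
    proof -
      have "real q * r = r + real (q - 1) * r"
        using 2(1) by (cases q) (auto simp: algebra_simps)
      then show ?thesis
        using Ts(3) Us(3) that by (simp add: add_mono)
    qed
    ultimately show ?thesis
      using expansion_append[OF Ts(1) Us(1)] by (intro exI[of _ ?Vs]) auto
  next
    case 3
    then have "q \<le> heavy_count (r ^ D) T"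
      using Cons.prems(4) by (simp add: heavy_count_def)
    with Cons.IH[of q] Cons.prems obtain Us where Us: "expansion T Us" "length Us \<le> s ^ q"
      "\<forall>U\<in>set Us. real q * r \<le> real (nonconst_count U)"
      by auto
    have "expansion [\<psi>] [[\<psi>]]"
      using Cons.prems(1) by (intro expansion_refl) auto
    from expansion_append[OF this Us(1)] have "expansion (\<psi> # T) (map ((@) [\<psi>]) Us)"
      by (simp add: o_def)
    moreover have "real q * r \<le> real (nonconst_count ([\<psi>] @ U))" if "U \<in> set Us" for U
      using Us(3) that unfolding nonconst_count_append by fastforce
    ultimately show ?thesis
      using Us(2) by (intro exI[of _ "map ((@) [\<psi>]) Us"]) auto
  qed
qed

text \<open>A heavy factor contributes at most \<tau>, any other non-constant one at most H, a
  constant one nothing.\<close>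

lemma sum_degree_le_heavy_count:
  assumes "\<And>\<psi>. \<psi> \<in> set T \<Longrightarrow> formula_degree \<psi> \<le> \<tau>" "H \<ge> 0"
  shows "real (\<Sum>\<psi>\<leftarrow>T. formula_degree \<psi>) \<le> real (heavy_count H T) * real \<tau> + real (nonconst_count T) * H"
  using assms(1)
proof (induction T)
  case (Cons \<psi> T)
  let ?k = "formula_degree \<psi>"
  have IH: "real (\<Sum>\<psi>\<leftarrow>T. formula_degree \<psi>) \<le> real (heavy_count H T) * real \<tau> + real (nonconst_count T) * H"
    using Cons by auto
  have "real ?k \<le> (if H < real ?k then real \<tau> else 0) + (if ?k > 0 then H else 0)"
    using Cons.prems[of \<psi>] assms(2) by auto
  with IH show ?case
    by (auto simp: heavy_count_def nonconst_count_def algebra_simps split: if_splits)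
qed (simp add: heavy_count_def nonconst_count_def)

text \<open>Terms of the threshold expansion that already have enough factors are kept, the others
  are expanded again. The 4 leaves room for light factors to carry a quarter of the degree.\<close>

lemma many_factors_expansion:
  fixes \<tau> :: nat
  assumes \<phi>: "nonzero_homogeneous \<phi>" and \<tau>: "1 \<le> \<tau>" "\<tau> < formula_degree \<phi>"
  defines "d \<equiv> formula_degree \<phi>" and "s \<equiv> formula_size \<phi>"
  shows "\<exists>Ts. expansion [\<phi>] Ts \<and> real (length Ts) \<le> real s powr (3 * (real d / real \<tau>)) \<and>
    (\<forall>T\<in>set Ts. (\<forall>\<psi>\<in>set T. formula_degree \<psi> \<le> \<tau>) \<and>
      real d / real \<tau> * real \<tau> powr (1 / real (product_depth \<phi>)) / 4 \<le> real (nonconst_count T))"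
proof -
  define \<Delta> where "\<Delta> = product_depth \<phi>"
  have \<Delta>: "\<Delta> > 0"
    using formula_degree_depth_0[OF \<phi>] \<tau> unfolding \<Delta>_def by linarith
  define r where "r = real \<tau> powr (1 / real \<Delta>)"
  have r: "r \<ge> 1"
    unfolding r_def using \<tau>(1) by (intro ge_one_powr_ge_zero) auto
  \<comment> \<open>The factors have product-depth at most \<Delta> - 1, so this is the threshold of
    the heavy path. It satisfies \<open>r * H = \<tau>\<close>.\<close>
  define H where "H = r ^ (\<Delta> - 1)"
  have "r ^ \<Delta> = real \<tau>"
    unfolding r_def using \<tau>(1) \<Delta> by (simp add: powr_power)
  then have rH: "r * H = real \<tau>"
    unfolding H_def using \<Delta> by (cases \<Delta>) auto
  have H0: "H \<ge> 0" unfolding H_def using r by simp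
  have s1: "real s \<ge> 1"
    unfolding s_def using formula_size_pos[of \<phi>] by simp
  have d\<tau>: "real d / real \<tau> \<ge> 1"
    using \<tau> unfolding d_def by (simp add: field_simps)
  \<comment> \<open>Half of \<open>d / \<tau>\<close>: few enough for the cost \<open>s ^ q\<close>,
    while \<open>q * r\<close> still exceeds the required number of factors.\<close>
  define q where "q = nat \<lceil>real d / (2 * real \<tau>)\<rceil>"
  have q1: "real d / (2 * real \<tau>) \<le> real q"
    unfolding q_def by linarith
  have q2: "real q \<le> real d / (2 * real \<tau>) + 1"
    unfolding q_def by (simp add: of_nat_ceiling)
  obtain Ts where Ts: "expansion [\<phi>] Ts" "real (length Ts) \<le> real s powr (real d / real \<tau>)"
    "\<And>T \<psi>. T \<in> set Ts \<Longrightarrow> \<psi> \<in> set T \<Longrightarrow> formula_degree \<psi> \<le> \<tau> \<and> product_depth \<psi> < \<Delta>"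
    using threshold_expansion[OF \<tau>(1) \<phi>] \<tau>(2) unfolding d_def s_def \<Delta>_def by blast
  have ref: "refinement [\<phi>] T" if "T \<in> set Ts" for T
    using Ts(1) that by (simp add: expansion_def)
  have "\<exists>Us. expansion T Us \<and> length Us \<le> s ^ q \<and>
      (\<forall>U\<in>set Us. real d / real \<tau> * r / 4 \<le> real (nonconst_count U))" if T: "T \<in> set Ts" for T
  proof (cases "real d / real \<tau> * r / 4 \<le> real (nonconst_count T)")
    case True
    have "expansion T [T]"
      using ref[OF T] by (intro expansion_refl) (auto simp: refinement_def)
    with True s1 show ?thesis
      by (intro exI[of _ "[T]"]) auto
  next
    case False
    \<comment> \<open>With too few factors, the light ones have total degree at most d / 4, as
      \<open>r * H = \<tau>\<close>. The heavy ones supply the other 3 d / 4, at most \<tau> each,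
      so there are more than enough to fill the quota q.\<close>
    have "real (nonconst_count T) * H \<le> real d / real \<tau> * r / 4 * H"
      using False H0 by (intro mult_right_mono) auto
    also have "\<dots> = real d / 4"
      using rH \<tau>(1) by (simp add: field_simps)
    finally have "real (nonconst_count T) * H \<le> real d / 4" .
    moreover have "real d \<le> real (heavy_count H T) * real \<tau> + real (nonconst_count T) * H"
      using sum_degree_le_heavy_count[of T \<tau> H] Ts(3)[OF T] H0 ref[OF T]
      by (simp add: refinement_def d_def)
    ultimately have "real d / (2 * real \<tau>) \<le> real (heavy_count H T)"
      using \<tau>(1) by (simp add: field_simps)
    then have "q \<le> heavy_count H T"
      unfolding q_def by (simp add: nat_le_iff ceiling_le_iff)
    moreover have "formula_size \<psi> \<le> s" if "\<psi> \<in> set T" for \<psi>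
      using member_le_sum_list[of "formula_size \<psi>" "map formula_size T"] that ref[OF T]
      by (auto simp: refinement_def s_def)
    ultimately obtain Us where Us: "expansion T Us" "length Us \<le> s ^ q"
        "\<forall>U\<in>set Us. real q * r \<le> real (nonconst_count U)"
      using heavy_expansion[of T "\<Delta> - 1" s r q] r Ts(3)[OF T] ref[OF T] \<Delta>
      unfolding H_def refinement_def by fastforce
    have "real d / real \<tau> * r / 4 \<le> real q * r"
    proof -
      have "0 \<le> real d / real \<tau> * r"
        using r by simp
      then have "real d / real \<tau> * r / 4 \<le> real d / real \<tau> * r / 2"
        by (intro divide_left_mono) auto
      also have "\<dots> = real d / (2 * real \<tau>) * r"
        by simp
      also have "\<dots> \<le> real q * r"
        using q1 r by (intro mult_right_mono) auto
      finally show ?thesis .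
    qed
    with Us show ?thesis
      by (meson order_trans)
  qed
  then obtain G where G: "\<And>T. T \<in> set Ts \<Longrightarrow> expansion T (G T) \<and> length (G T) \<le> s ^ q \<and>
      (\<forall>U\<in>set (G T). real d / real \<tau> * r / 4 \<le> real (nonconst_count U))"
    by metis
  let ?Us = "concat (map G Ts)"
  have "length ?Us \<le> (\<Sum>T\<leftarrow>Ts. s ^ q)"
    unfolding length_concat_map using G by (intro sum_list_mono) blast
  then have "real (length ?Us) \<le> real (length Ts) * real s ^ q"
    by (simp add: sum_list_triv) (metis of_nat_le_iff of_nat_mult of_nat_power)
  also have "\<dots> \<le> real s powr (real d / real \<tau>) * real s powr (real d / (2 * real \<tau>) + 1)"
    using Ts(2) s1 q2 by (intro mult_mono) (auto simp flip: powr_realpow intro!: powr_mono)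
  also have "\<dots> = real s powr (real d / real \<tau> + (real d / (2 * real \<tau>) + 1))"
    by (simp only: powr_add)
  \<comment> \<open>The exponent is 3/2 times \<open>d / \<tau>\<close>, plus 1 from rounding q up;
    this 1 is absorbed because \<open>d / \<tau>\<close> is at least 1.\<close>
  also have "\<dots> \<le> real s powr (3 * (real d / real \<tau>))"
    using s1 d\<tau> by (intro powr_mono) (auto simp: field_simps)
  finally have "real (length ?Us) \<le> real s powr (3 * (real d / real \<tau>))" .
  moreover have "formula_degree \<psi> \<le> \<tau>" if "T \<in> set Ts" "U \<in> set (G T)" "\<psi> \<in> set U" for T U \<psi>
  proof -
    from G[OF that(1)] that(2,3) obtain \<chi> where "\<chi> \<in> set T" "refined_by \<chi> \<psi>"
      unfolding expansion_def refinement_def by blast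
    then show ?thesis
      using Ts(3)[OF that(1)] unfolding refined_by_def by fastforce
  qed
  ultimately show ?thesis
    using expansion_concat[OF Ts(1), of G] G
    unfolding r_def \<Delta>_def by (intro exI[of _ ?Us]) auto
qed


section \<open>Assembling depth-four circuits\<close>

lemma circuit_polys_Nil [simp]: "circuit_polys [] = []"
  by (simp add: circuit_polys_def)

lemma circuit_polys_snoc:
  "circuit_polys (C @ [g]) = circuit_polys C @ [gate_poly (circuit_polys C) g]"
  by (simp add: circuit_polys_def)

lemma length_circuit_polys [simp]: "length (circuit_polys C) = length C"
  by (induction C rule: rev_induct) (auto simp: circuit_polys_snoc)

lemma circuit_polys_append: "\<exists>ps. circuit_polys (C @ D) = circuit_polys C @ ps"
proof (induction D rule: rev_induct)
  case (snoc g D)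
  then show ?case
    using circuit_polys_snoc[of "C @ D" g] by auto
qed simp

lemma circuit_polys_append_nth: "k < length C \<Longrightarrow> circuit_polys (C @ D) ! k = circuit_polys C ! k"
  using circuit_polys_append[of C D] by (auto simp: nth_append)

lemma circuit_size_append: "circuit_size (C @ D) = circuit_size C + circuit_size D"
  by (simp add: circuit_size_def)

section \<open>Building circuits by appending gates\<close>

text \<open>An invariant for partial circuits: it admits the empty list, from which the construction
  starts, and confines inputs to V.\<close>

definition valid_circuit :: "nat set \<Rightarrow> 'a::field circuit \<Rightarrow> bool" where
  "valid_circuit V C \<longleftrightarrow> (\<forall>k<length C. \<forall>j\<in>set (gate_children (C ! k)). j < k) \<and>
     (\<forall>i. Input i \<in> set C \<longrightarrow> i \<in> V) \<and> homogeneous_circuit C"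

lemma valid_circuit_Nil: "valid_circuit V []"
  by (simp add: valid_circuit_def homogeneous_circuit_def)

lemma valid_circuit_snoc:
  assumes "valid_circuit V C" "\<And>j. j \<in> set (gate_children g) \<Longrightarrow> j < length C"
    "\<And>i. g = Input i \<Longrightarrow> i \<in> V" "homogeneous_poly (gate_poly (circuit_polys C) g)"
  shows "valid_circuit V (C @ [g])"
  using assms unfolding valid_circuit_def homogeneous_circuit_def
  by (auto simp: nth_append circuit_polys_snoc less_Suc_eq)

lemma valid_circuit_children:
  "valid_circuit V C \<Longrightarrow> k < length C \<Longrightarrow> j \<in> set (gate_children (C ! k)) \<Longrightarrow> j < k"
  by (auto simp: valid_circuit_def)

text \<open>Appending gates moves no earlier gate, and in a valid circuit a gate refers only to
  earlier ones, so what is known about it survives.\<close>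

definition persistent :: "nat set \<Rightarrow> ('a::field circuit \<Rightarrow> nat \<Rightarrow> bool) \<Rightarrow> bool" where
  "persistent V P \<longleftrightarrow> (\<forall>C D k. valid_circuit V C \<longrightarrow> k < length C \<longrightarrow> P C k \<longrightarrow> P (C @ D) k)"

text \<open>Quantifying over all starting circuits makes costs additive: each part is appended
  behind whatever is already there, without sharing.\<close>

definition buildable :: "nat set \<Rightarrow> ('a::field circuit \<Rightarrow> nat \<Rightarrow> bool) \<Rightarrow> nat \<Rightarrow> bool" where
  "buildable V P c \<longleftrightarrow> (\<forall>C. valid_circuit V C \<longrightarrow>
     (\<exists>D k. valid_circuit V (C @ D) \<and> k < length (C @ D) \<and> P (C @ D) k \<and> circuit_size D \<le> c))"

lemma buildable_list:
  assumes "\<And>x. x \<in> set xs \<Longrightarrow> persistent V (P x)" "\<And>x. x \<in> set xs \<Longrightarrow> buildable V (P x) c"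
    and "valid_circuit V C"
  shows "\<exists>D ks. valid_circuit V (C @ D) \<and> circuit_size D \<le> length xs * c \<and>
    list_all2 (\<lambda>x k. k < length (C @ D) \<and> P x (C @ D) k) xs ks"
  using assms(1,2)
proof (induction xs rule: rev_induct)
  case Nil
  show ?case
    using assms(3) by (intro exI[of _ "[]"]) (auto simp: circuit_size_def)
next
  case (snoc x xs)
  then obtain D ks where D: "valid_circuit V (C @ D)" "circuit_size D \<le> length xs * c"
    "list_all2 (\<lambda>x k. k < length (C @ D) \<and> P x (C @ D) k) xs ks"
    by auto
  have "buildable V (P x) c"
    using snoc.prems(2) by simp
  with D(1) obtain E k where E: "valid_circuit V ((C @ D) @ E)" "k < length ((C @ D) @ E)"
    "P x ((C @ D) @ E) k" "circuit_size E \<le> c"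
    unfolding buildable_def by blast
  have "list_all2 (\<lambda>x k. k < length ((C @ D) @ E) \<and> P x ((C @ D) @ E) k) xs ks"
    using D(3)
  proof (rule list.rel_mono_strong)
    fix y j assume "y \<in> set xs" "j < length (C @ D) \<and> P y (C @ D) j"
    then show "j < length ((C @ D) @ E) \<and> P y ((C @ D) @ E) j"
      using snoc.prems(1)[of y] D(1) unfolding persistent_def by auto
  qed
  with D E show ?case
    by (intro exI[of _ "D @ E"] exI[of _ "ks @ [k]"])
      (auto simp: circuit_size_append intro!: list_all2_appendI)
qed

definition computes :: "'a::field circuit \<Rightarrow> nat \<Rightarrow> 'a mpoly \<Rightarrow> bool" where
  "computes C k p \<longleftrightarrow> circuit_polys C ! k = p"

lemma computes_append: "k < length C \<Longrightarrow> computes (C @ D) k p \<longleftrightarrow> computes C k p"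
  by (simp add: computes_def circuit_polys_append_nth)

lemma computes_map:
  assumes "list_all2 (\<lambda>x k. k < length C \<and> P x C k \<and> computes C k (g x)) xs ks"
  shows "map (\<lambda>k. circuit_polys C ! k) ks = map g xs"
  using assms by (induction rule: list_all2_induct) (auto simp: computes_def)

lemma list_all2_right:
  assumes "list_all2 R xs ks" "k \<in> set ks"
  obtains x where "x \<in> set xs" "R x k"
  using assms by (metis list_all2_conv_all_nth in_set_conv_nth)

section \<open>The layers of a depth-four circuit\<close>

definition leaf_gate :: "nat set \<Rightarrow> 'a gate \<Rightarrow> bool" where
  "leaf_gate V g \<longleftrightarrow> (\<exists>i\<in>V. g = Input i) \<or> (\<exists>c. g = Scalar c)"

text \<open>A leaf refers to no earlier gate, so the list of earlier polynomials may be taken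
  empty.\<close>

abbreviation leaf_poly :: "'a::field gate \<Rightarrow> 'a mpoly" where
  "leaf_poly g \<equiv> gate_poly [] g"

lemma homogeneous_leaf: "leaf_gate V g \<Longrightarrow> homogeneous_poly (leaf_poly g)"
  by (auto simp: leaf_gate_def intro: hom_of_degree_imp_homogeneous[OF hom_of_degree_mp_var]
      hom_of_degree_imp_homogeneous[OF hom_of_degree_mp_const])

lemma bottom_product_append:
  assumes "valid_circuit V C" "k < length C" "bottom_product t C k"
  shows "bottom_product t (C @ D) k"
proof -
  from assms(3) obtain ls where ls: "C ! k = Times ls" "length ls \<le> t"
    "\<And>l. l \<in> set ls \<Longrightarrow> (\<exists>i. C ! l = Input i) \<or> (\<exists>c. C ! l = Scalar c)"
    unfolding bottom_product_def by auto
  have "l < length C" if "l \<in> set ls" for l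
    using valid_circuit_children[OF assms(1,2), of l] that assms(2) ls(1) by simp
  with ls assms(2) show ?thesis
    unfolding bottom_product_def by (auto simp: nth_append)
qed

lemma bottom_sum_append:
  assumes "valid_circuit V C" "k < length C" "bottom_sum t C k"
  shows "bottom_sum t (C @ D) k"
proof -
  from assms(3) obtain ls where ls: "C ! k = Plus ls" "\<And>l. l \<in> set ls \<Longrightarrow> bottom_product t C l"
    unfolding bottom_sum_def by auto
  have "bottom_product t (C @ D) l" if "l \<in> set ls" for l
  proof (rule bottom_product_append[OF assms(1) _ ls(2)[OF that]])
    show "l < length C"
      using valid_circuit_children[OF assms(1,2), of l] that assms(2) ls(1) by simp
  qed
  moreover have "(C @ D) ! k = Plus ls"
    using ls(1) assms(2) by (simp add: nth_append)
  ultimately show ?thesis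
    unfolding bottom_sum_def by blast
qed

lemma top_product_append:
  assumes "valid_circuit V C" "k < length C" "top_product t C k"
  shows "top_product t (C @ D) k"
proof -
  from assms(3) obtain ls where ls: "C ! k = Times ls" "\<And>l. l \<in> set ls \<Longrightarrow> bottom_sum t C l"
    unfolding top_product_def by auto
  have "bottom_sum t (C @ D) l" if "l \<in> set ls" for l
  proof (rule bottom_sum_append[OF assms(1) _ ls(2)[OF that]])
    show "l < length C"
      using valid_circuit_children[OF assms(1,2), of l] that assms(2) ls(1) by simp
  qed
  moreover have "(C @ D) ! k = Times ls"
    using ls(1) assms(2) by (simp add: nth_append)
  ultimately show ?thesis
    unfolding top_product_def by blast
qed

lemma nontrivial_fanin_append:
  assumes "valid_circuit V C" "k < length C"
  shows "nontrivial_fanin (C @ D) k = nontrivial_fanin C k"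
proof -
  have "l < length C" if "l \<in> set (gate_children (C ! k))" for l
    using valid_circuit_children[OF assms, of l] that assms(2) by simp
  then show ?thesis
    unfolding nontrivial_fanin_def using assms(2)
    by (simp add: nth_append circuit_polys_append_nth cong: filter_cong)
qed

lemma persistent_gate: "persistent V (\<lambda>C k. C ! k = g \<and> computes C k p)"
  unfolding persistent_def by (auto simp: nth_append computes_append)

lemma persistent_bottom_product: "persistent V (\<lambda>C k. bottom_product t C k \<and> computes C k p)"
  unfolding persistent_def by (simp add: computes_append bottom_product_append)

lemma persistent_bottom_sum: "persistent V (\<lambda>C k. bottom_sum t C k \<and> computes C k p)"
  unfolding persistent_def by (simp add: computes_append bottom_sum_append)

lemma persistent_top_product:
  "persistent V (\<lambda>C k. (top_product t C k \<and> a \<le> nontrivial_fanin C k) \<and> computes C k p)"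
  unfolding persistent_def by (simp add: computes_append nontrivial_fanin_append top_product_append)

lemma buildable_leaf:
  assumes "leaf_gate V g"
  shows "buildable V (\<lambda>C k. C ! k = g \<and> computes C k (leaf_poly g)) 1"
  unfolding buildable_def
proof (intro allI impI)
  fix C :: "'a circuit" assume C: "valid_circuit V C"
  have g: "gate_poly (circuit_polys C) g = leaf_poly g" "gate_children g = []"
    using assms by (auto simp: leaf_gate_def)
  have "valid_circuit V (C @ [g])"
    using assms C homogeneous_leaf[OF assms] by (intro valid_circuit_snoc) (auto simp: g leaf_gate_def)
  then show "\<exists>D k. valid_circuit V (C @ D) \<and> k < length (C @ D) \<and>
      ((C @ D) ! k = g \<and> computes (C @ D) k (leaf_poly g)) \<and> circuit_size D \<le> 1"
    by (intro exI[of _ "[g]"] exI[of _ "length C"])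
      (simp add: computes_def circuit_polys_snoc nth_append circuit_size_def g)
qed

text \<open>The common step of all inner layers: build the children, then append one gate G. The
  cost is c and one wire for each child, plus the gate itself.\<close>

lemma buildable_gate:
  fixes G :: "nat list \<Rightarrow> 'a::field gate"
  assumes x: "\<And>x. x \<in> set xs \<Longrightarrow> persistent V (\<lambda>C k. P x C k \<and> computes C k (g x))"
      "\<And>x. x \<in> set xs \<Longrightarrow> buildable V (\<lambda>C k. P x C k \<and> computes C k (g x)) c"
    and G: "\<And>ks. gate_children (G ks) = ks" "\<And>ks i. G ks \<noteq> Input i"
      "\<And>ps ks. map (\<lambda>k. ps ! k) ks = map g xs \<Longrightarrow> gate_poly ps (G ks) = p"
    and p: "homogeneous_poly p"
    and Q: "\<And>C ks. valid_circuit V C \<Longrightarrow>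
      list_all2 (\<lambda>x k. k < length C \<and> P x C k \<and> computes C k (g x)) xs ks \<Longrightarrow> Q (C @ [G ks]) (length C)"
  shows "buildable V (\<lambda>C k. Q C k \<and> computes C k p) (length xs * (c + 1) + 1)"
  unfolding buildable_def
proof (intro allI impI)
  fix C :: "'a circuit" assume "valid_circuit V C"
  from buildable_list[where P = "\<lambda>x C k. P x C k \<and> computes C k (g x)", OF x this]
  obtain D ks where D: "valid_circuit V (C @ D)" "circuit_size D \<le> length xs * c"
    and ks: "list_all2 (\<lambda>x k. k < length (C @ D) \<and> P x (C @ D) k \<and> computes (C @ D) k (g x)) xs ks"
    by blast
  have ks_less: "k < length (C @ D)" if "k \<in> set ks" for k
    using list_all2_right[OF ks that] by blast
  have poly: "gate_poly (circuit_polys (C @ D)) (G ks) = p"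
    using computes_map[where P = P and g = g, OF ks] by (rule G(3))
  have valid: "valid_circuit V ((C @ D) @ [G ks])"
    using D(1) ks_less p poly by (intro valid_circuit_snoc) (auto simp: G)
  have "length ks = length xs"
    using ks by (simp add: list_all2_lengthD)
  then have "circuit_size (D @ [G ks]) \<le> length xs * (c + 1) + 1"
    using D(2) by (simp add: circuit_size_append circuit_size_def G)
  moreover have "computes ((C @ D) @ [G ks]) (length (C @ D)) p"
    unfolding computes_def circuit_polys_snoc poly by (simp add: nth_append)
  ultimately show "\<exists>D k. valid_circuit V (C @ D) \<and> k < length (C @ D) \<and>
      (Q (C @ D) k \<and> computes (C @ D) k p) \<and> circuit_size D \<le> length xs * (c + 1) + 1"
    using valid Q[OF D(1) ks]
    by (intro exI[of _ "D @ [G ks]"] exI[of _ "length (C @ D)"]) auto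
qed

lemma buildable_mono: "buildable V P c \<Longrightarrow> c \<le> c' \<Longrightarrow> buildable V P c'"
  unfolding buildable_def by (meson order_trans)

lemma buildable_bottom_product:
  assumes "\<And>g. g \<in> set ls \<Longrightarrow> leaf_gate V g" "length ls \<le> t"
  shows "buildable V (\<lambda>C k. bottom_product t C k \<and> computes C k (\<Prod>g\<leftarrow>ls. leaf_poly g)) (2 * t + 1)"
proof -
  have "buildable V (\<lambda>C k. bottom_product t C k \<and> computes C k (\<Prod>g\<leftarrow>ls. leaf_poly g))
      (length ls * (1 + 1) + 1)"
  proof (rule buildable_gate[where P = "\<lambda>g C k. C ! k = g" and g = leaf_poly and G = Times])
    show "homogeneous_poly (\<Prod>g\<leftarrow>ls. leaf_poly g)"
      using assms(1) by (intro homogeneous_poly_prod_list homogeneous_leaf)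
  next
    fix C :: "'a circuit" and ks
    assume ks: "list_all2 (\<lambda>g k. k < length C \<and> C ! k = g \<and> computes C k (leaf_poly g)) ls ks"
    have "(\<exists>i. C ! k = Input i) \<or> (\<exists>c. C ! k = Scalar c)" "k < length C" if k: "k \<in> set ks" for k
      using list_all2_right[OF ks k] assms(1) unfolding leaf_gate_def by blast+
    moreover have "length ks \<le> t"
      using ks assms(2) by (simp add: list_all2_lengthD)
    ultimately show "bottom_product t (C @ [Times ks]) (length C)"
      unfolding bottom_product_def by (simp add: nth_append)
  next
    show "persistent V (\<lambda>C k. C ! k = g \<and> computes C k (leaf_poly g))" for g
      by (rule persistent_gate)
  next
    show "buildable V (\<lambda>C k. C ! k = g \<and> computes C k (leaf_poly g)) 1" if "g \<in> set ls" for g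
      using assms(1)[OF that] by (rule buildable_leaf)
  qed simp_all
  then show ?thesis
    by (rule buildable_mono) (use assms(2) in simp)
qed

text \<open>The polynomials that a single bottom sum can compute, N bounding its fan-in. Homogeneity
  is required of the sum only; products of leaves are always homogeneous.\<close>

definition sum_of_leaf_products :: "nat set \<Rightarrow> nat \<Rightarrow> nat \<Rightarrow> 'a::field mpoly \<Rightarrow> bool" where
  "sum_of_leaf_products V t N p \<longleftrightarrow> homogeneous_poly p \<and>
     (\<exists>Ls. p = (\<Sum>ls\<leftarrow>Ls. \<Prod>g\<leftarrow>ls. leaf_poly g) \<and> length Ls \<le> N \<and>
        (\<forall>ls\<in>set Ls. length ls \<le> t \<and> (\<forall>g\<in>set ls. leaf_gate V g)))"

lemma buildable_bottom_sum:
  assumes "sum_of_leaf_products V t N p"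
  shows "buildable V (\<lambda>C k. bottom_sum t C k \<and> computes C k p) (N * (2 * t + 2) + 1)"
proof -
  from assms obtain Ls where Ls: "homogeneous_poly p" "p = (\<Sum>ls\<leftarrow>Ls. \<Prod>g\<leftarrow>ls. leaf_poly g)" "length Ls \<le> N"
    "\<And>ls. ls \<in> set Ls \<Longrightarrow> length ls \<le> t" "\<And>ls g. ls \<in> set Ls \<Longrightarrow> g \<in> set ls \<Longrightarrow> leaf_gate V g"
    unfolding sum_of_leaf_products_def by blast
  have "buildable V (\<lambda>C k. bottom_sum t C k \<and> computes C k p) (length Ls * (2 * t + 1 + 1) + 1)"
  proof (rule buildable_gate[where P = "\<lambda>_. bottom_product t" and g = "\<lambda>ls. \<Prod>g\<leftarrow>ls. leaf_poly g" and G = Plus])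
    fix C :: "'a circuit" and ks
    assume C: "valid_circuit V C"
      and ks: "list_all2 (\<lambda>ls k. k < length C \<and> bottom_product t C k \<and> computes C k (\<Prod>g\<leftarrow>ls. leaf_poly g)) Ls ks"
    have "bottom_product t (C @ [Plus ks]) k" if "k \<in> set ks" for k
    proof -
      have "k < length C" "bottom_product t C k"
        using list_all2_right[OF ks that] by blast+
      then show ?thesis
        by (rule bottom_product_append[OF C])
    qed
    then show "bottom_sum t (C @ [Plus ks]) (length C)"
      unfolding bottom_sum_def by (simp add: nth_append)
  next
    show "buildable V (\<lambda>C k. bottom_product t C k \<and> computes C k (\<Prod>g\<leftarrow>ls. leaf_poly g)) (2 * t + 1)"
      if "ls \<in> set Ls" for ls
      using Ls(4,5) that by (intro buildable_bottom_product) auto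
  next
    show "persistent V (\<lambda>C k. bottom_product t C k \<and> computes C k (\<Prod>g\<leftarrow>ls. leaf_poly g))" for ls
      by (rule persistent_bottom_product)
  qed (simp_all add: Ls(1) Ls(2)[symmetric])
  then show ?thesis
    by (rule buildable_mono) (use mult_le_mono1[OF Ls(3), of "2 * t + 2"] in simp)
qed

lemma buildable_top_product:
  assumes "\<And>p. p \<in> set T \<Longrightarrow> sum_of_leaf_products V t N p" "length T \<le> L"
    and "a \<le> length (filter (\<lambda>p. total_degree p > 0) T)"
  shows "buildable V (\<lambda>C k. (top_product t C k \<and> a \<le> nontrivial_fanin C k) \<and> computes C k (prod_list T))
    (L * (N * (2 * t + 2) + 2) + 1)"
proof -
  have "buildable V (\<lambda>C k. (top_product t C k \<and> a \<le> nontrivial_fanin C k) \<and> computes C k (prod_list T))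
    (length T * (N * (2 * t + 2) + 1 + 1) + 1)"
  proof (rule buildable_gate[where P = "\<lambda>_. bottom_sum t" and g = "\<lambda>p. p" and G = Times])
    show "homogeneous_poly (prod_list T)"
      using homogeneous_poly_prod_list[of T "\<lambda>p. p"] assms(1) by (simp add: sum_of_leaf_products_def)
  next
    fix C :: "'a circuit" and ks
    assume C: "valid_circuit V C"
      and ks: "list_all2 (\<lambda>p k. k < length C \<and> bottom_sum t C k \<and> computes C k p) T ks"
    have "bottom_sum t (C @ [Times ks]) k" if "k \<in> set ks" for k
    proof -
      have "k < length C" "bottom_sum t C k"
        using list_all2_right[OF ks that] by blast+
      then show ?thesis
        by (rule bottom_sum_append[OF C])
    qed
    then have "top_product t (C @ [Times ks]) (length C)"
      unfolding top_product_def by (simp add: nth_append)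
    moreover have M: "map (\<lambda>k. circuit_polys (C @ [Times ks]) ! k) ks = T"
    proof -
      have "map (\<lambda>k. circuit_polys (C @ [Times ks]) ! k) ks = map (\<lambda>k. circuit_polys C ! k) ks"
        using list_all2_right[OF ks] by (intro map_cong refl circuit_polys_append_nth) blast
      also have "\<dots> = T"
        using computes_map[where P = "\<lambda>_. bottom_sum t" and g = "\<lambda>p. p", OF ks] by simp
      finally show ?thesis .
    qed
    have "nontrivial_fanin (C @ [Times ks]) (length C) = length (filter (\<lambda>p. total_degree p > 0)
        (map (\<lambda>k. circuit_polys (C @ [Times ks]) ! k) ks))"
      by (simp add: nontrivial_fanin_def filter_map o_def)
    then have "nontrivial_fanin (C @ [Times ks]) (length C) = length (filter (\<lambda>p. total_degree p > 0) T)"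
      unfolding M .
    ultimately show "top_product t (C @ [Times ks]) (length C) \<and> a \<le> nontrivial_fanin (C @ [Times ks]) (length C)"
      using assms(3) by simp
  next
    show "persistent V (\<lambda>C k. bottom_sum t C k \<and> computes C k p)" for p
      by (rule persistent_bottom_sum)
  next
    show "buildable V (\<lambda>C k. bottom_sum t C k \<and> computes C k p) (N * (2 * t + 2) + 1)" if "p \<in> set T" for p
      using assms(1)[OF that] by (rule buildable_bottom_sum)
  qed simp_all
  then show ?thesis
    by (rule buildable_mono) (use mult_le_mono1[OF assms(2), of "N * (2 * t + 2) + 2"] in simp)
qed

text \<open>The interface between the algebra and the circuits: a sum of products of bottom sums
  becomes a circuit with one top product per term.\<close>

lemma depth_four_circuit:
  assumes f: "homogeneous_poly f" "f = (\<Sum>T\<leftarrow>Ts. prod_list T)"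
    and Ts: "\<And>T p. T \<in> set Ts \<Longrightarrow> p \<in> set T \<Longrightarrow> sum_of_leaf_products V t N p"
      "\<And>T. T \<in> set Ts \<Longrightarrow> length T \<le> L"
      "\<And>T. T \<in> set Ts \<Longrightarrow> a \<le> length (filter (\<lambda>p. total_degree p > 0) T)"
    and V: "V \<subseteq> {..<n}"
  shows "\<exists>C. wf_circuit n C \<and> circuit_poly C = f \<and> homogeneous_circuit C \<and> depth_four_fanin a t C \<and>
    top_fanin C = length Ts \<and> circuit_size C \<le> length Ts * (L * (N * (2 * t + 2) + 2) + 2) + 1"
proof -
  let ?P = "\<lambda>C k. top_product t C k \<and> a \<le> nontrivial_fanin C k"
  let ?c = "L * (N * (2 * t + 2) + 2) + 1"
  have "buildable V (\<lambda>C k. ?P C k \<and> computes C k (prod_list T)) ?c" if "T \<in> set Ts" for T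
    by (rule buildable_top_product[OF Ts(1)[OF that] Ts(2)[OF that] Ts(3)[OF that]])
  from buildable_list[where xs = Ts and P = "\<lambda>T C k. ?P C k \<and> computes C k (prod_list T)",
      OF persistent_top_product this valid_circuit_Nil]
  obtain D ks where D: "valid_circuit V D" "circuit_size D \<le> length Ts * ?c"
    and ks: "list_all2 (\<lambda>T k. k < length D \<and> ?P D k \<and> computes D k (prod_list T)) Ts ks"
    unfolding append_Nil by blast
  let ?C = "D @ [Plus ks]"
  have ks_less: "k < length D" if "k \<in> set ks" for k
    using list_all2_right[OF ks that] by blast
  have poly: "gate_poly (circuit_polys D) (Plus ks) = f"
    using computes_map[where P = "\<lambda>_. ?P" and g = prod_list, OF ks] f(2) by simp
  have valid: "valid_circuit V ?C"
    using D(1) ks_less f(1) poly by (intro valid_circuit_snoc) auto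
  have len: "length ks = length Ts"
    using ks by (simp add: list_all2_lengthD)
  have top: "top_product t ?C k \<and> a \<le> nontrivial_fanin ?C k" if "k \<in> set ks" for k
  proof -
    have "k < length D" "?P D k"
      using list_all2_right[OF ks that] by blast+
    then show ?thesis
      using top_product_append[OF D(1)] nontrivial_fanin_append[OF D(1)] by simp
  qed
  have "wf_circuit n ?C"
    using valid V unfolding valid_circuit_def wf_circuit_def by auto
  moreover have "circuit_poly ?C = f"
    unfolding circuit_poly_def circuit_polys_snoc poly by simp
  moreover have "homogeneous_circuit ?C"
    using valid by (simp add: valid_circuit_def)
  moreover have "depth_four_fanin a t ?C"
    using top by (simp add: depth_four_fanin_def depth_four_def)
  moreover have "top_fanin ?C = length Ts"
    by (simp add: top_fanin_def len)
  moreover have "circuit_size ?C \<le> length Ts * (L * (N * (2 * t + 2) + 2) + 2) + 1"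
    using D(2) by (simp add: circuit_size_append circuit_size_def len)
  ultimately show ?thesis by blast
qed


section \<open>The depth reduction\<close>

lemma sum_of_leaf_products_low_degree:
  assumes "hom_of_degree k p" "k < t" "mp_vars p \<subseteq> V" "finite V" "card V \<le> s" "1 \<le> s"
  shows "sum_of_leaf_products V t (s ^ t) p"
proof -
  obtain Ms where Ms: "p = (\<Sum>(c, is)\<leftarrow>Ms. mp_const c * (\<Prod>i\<leftarrow>is. mp_var i))"
    "length Ms = card (Poly_Mapping.keys p)"
    "\<And>c is. (c, is) \<in> set Ms \<Longrightarrow> length is = k \<and> set is \<subseteq> mp_vars p"
    using hom_poly_sum_monomials[OF assms(1)] by blast
  \<comment> \<open>The scalar takes one input, so each product has k + 1 leaves; this is the reason
    for the strict bound on k.\<close>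
  let ?Ls = "map (\<lambda>(c, is). Scalar c # map Input is) Ms"
  have "length ?Ls \<le> card V ^ k"
    using card_keys_hom[OF assms(1,3,4)] by (simp add: Ms(2))
  also have "\<dots> \<le> s ^ k"
    using assms(5) by (rule power_mono) simp
  also have "\<dots> \<le> s ^ t"
    using assms(2,6) by (intro power_increasing) auto
  finally have "length ?Ls \<le> s ^ t" .
  moreover have "p = (\<Sum>ls\<leftarrow>?Ls. \<Prod>g\<leftarrow>ls. leaf_poly g)"
    unfolding Ms(1) by (simp add: o_def split_def)
  moreover have "length ls \<le> t \<and> (\<forall>g\<in>set ls. leaf_gate V g)" if "ls \<in> set ?Ls" for ls
    using that Ms(3) assms(2,3) by (fastforce simp: leaf_gate_def)
  ultimately show ?thesis
    unfolding sum_of_leaf_products_def using hom_of_degree_imp_homogeneous[OF assms(1)] by blast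
qed

lemma sum_of_leaf_products_leaf:
  assumes "leaf_gate V g" "1 \<le> t"
  shows "sum_of_leaf_products V t 1 (leaf_poly g)"
  unfolding sum_of_leaf_products_def using assms homogeneous_leaf[OF assms(1)]
  by (intro conjI exI[of _ "[[g]]"]) auto

lemma total_degree_mp_var: "total_degree (mp_var i) = 1"
  by (rule total_degree_hom[OF hom_of_degree_mp_var])
    (metis lookup_single_eq lookup_zero mp_var_def zero_neq_one)

text \<open>For \<open>t = 1\<close> a bottom product has no room for the coefficient of a variable, so the
  polynomial is split into its monomials at the top gate.\<close>

lemma monomial_circuit:
  fixes f :: "'a::field mpoly"
  assumes "hom_of_degree d f" "mp_vars f \<subseteq> V" "finite V" "card V \<le> s" "V \<subseteq> {..<n}" "1 \<le> t"
  shows "\<exists>C. wf_circuit n C \<and> circuit_poly C = f \<and> homogeneous_circuit C \<and> depth_four_fanin d t C \<and>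
    top_fanin C \<le> s ^ d \<and> circuit_size C \<le> s ^ d * ((d + 1) * (2 * t + 4) + 2) + 1"
proof -
  obtain Ms where Ms: "f = (\<Sum>(c, is)\<leftarrow>Ms. mp_const c * (\<Prod>i\<leftarrow>is. mp_var i))"
    "length Ms = card (Poly_Mapping.keys f)"
    "\<And>c is. (c, is) \<in> set Ms \<Longrightarrow> length is = d \<and> set is \<subseteq> mp_vars f"
    using hom_poly_sum_monomials[OF assms(1)] by blast
  \<comment> \<open>The coefficient and each variable are separate factors, every one a sum of one
    product of one leaf; so a term has d + 1 factors, of which the d variables are
    non-constant.\<close>
  let ?Ts = "map (\<lambda>(c, is). mp_const c # map mp_var is) Ms"
  have len: "length ?Ts \<le> s ^ d"
    using card_keys_hom[OF assms(1-3)] power_mono[OF assms(4), of d] by (simp add: Ms(2))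
  have "\<exists>C. wf_circuit n C \<and> circuit_poly C = f \<and> homogeneous_circuit C \<and> depth_four_fanin d t C \<and>
    top_fanin C = length ?Ts \<and> circuit_size C \<le> length ?Ts * ((d + 1) * (1 * (2 * t + 2) + 2) + 2) + 1"
  proof (rule depth_four_circuit[where V = V])
    show "homogeneous_poly f"
      by (rule hom_of_degree_imp_homogeneous[OF assms(1)])
    show "f = sum_list (map prod_list ?Ts)"
      unfolding Ms(1) by (simp add: o_def split_def)
  next
    fix T assume "T \<in> set ?Ts"
    then obtain c "is" where T: "(c, is) \<in> set Ms" "T = mp_const c # map mp_var is"
      by auto
    with Ms(3) have "is": "length is = d" "set is \<subseteq> V"
      using assms(2) by blast+
    show "length T \<le> d + 1"
      using T(2) "is" by simp
    have "length (filter (\<lambda>p. total_degree p > 0) (map mp_var is :: 'a mpoly list)) = length is"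
      by (simp add: filter_map o_def total_degree_mp_var)
    then show "d \<le> length (filter (\<lambda>p. total_degree p > 0) T)"
      using T(2) "is" by simp
    show "sum_of_leaf_products V t 1 p" if "p \<in> set T" for p
    proof -
      have "p = leaf_poly (Scalar c) \<or> (\<exists>i\<in>V. p = leaf_poly (Input i))"
        using that T(2) "is" by auto
      then obtain g where "leaf_gate V g" "p = leaf_poly g"
        unfolding leaf_gate_def by blast
      then show ?thesis
        using sum_of_leaf_products_leaf[OF _ assms(6)] by blast
    qed
  qed (rule assms(5))
  then obtain C where C: "wf_circuit n C" "circuit_poly C = f" "homogeneous_circuit C" "depth_four_fanin d t C"
    "top_fanin C = length ?Ts" "circuit_size C \<le> length ?Ts * ((d + 1) * (1 * (2 * t + 2) + 2) + 2) + 1"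
    by blast
  have "length ?Ts * ((d + 1) * (1 * (2 * t + 2) + 2) + 2) \<le> s ^ d * ((d + 1) * (2 * t + 4) + 2)"
  proof -
    have "(d + 1) * (1 * (2 * t + 2) + 2) + 2 = (d + 1) * (2 * t + 4) + 2"
      by (simp add: algebra_simps)
    then show ?thesis
      using mult_le_mono1[OF len, of "(d + 1) * (2 * t + 4) + 2"] by (simp only:)
  qed
  with C len show ?thesis
    by (intro exI[of _ C]) linarith
qed

section \<open>Numerical estimates and the reduction for a single formula\<close>

lemma depth_four_fanin_mono: "depth_four_fanin a t C \<Longrightarrow> b \<le> a \<Longrightarrow> depth_four_fanin b t C"
  unfolding depth_four_fanin_def by (meson order_trans)

text \<open>The left side is the cost per top product, with at most s factors of at most
  \<open>s ^ t\<close> monomials each. Since s is at least 2, \<open>2 * t + 2\<close> is at most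
  \<open>s ^ (2 * t)\<close>, and each added 2 costs one further factor s; the exponent 3 t + 3 is
  at most 6 t.\<close>

lemma size_bound_aux:
  fixes s t :: nat
  assumes "2 \<le> s" "1 \<le> t"
  shows "s * (s ^ t * (2 * t + 2) + 2) + 2 \<le> s ^ (6 * t)"
proof -
  have p: "1 \<le> s ^ k" for k
    using assms(1) by simp
  have "2 * t + 2 \<le> 2 ^ (2 * t)"
    using assms(2)
  proof (induction t rule: dec_induct)
    case (step t)
    then show ?case by simp
  qed simp
  also have "\<dots> \<le> s ^ (2 * t)"
    using assms(1) by (intro power_mono) auto
  finally have "s ^ t * (2 * t + 2) \<le> s ^ t * s ^ (2 * t)"
    by (rule mult_le_mono2)
  also have "\<dots> = s ^ (3 * t)"
    by (simp flip: power_add)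
  finally have 1: "s ^ t * (2 * t + 2) \<le> s ^ (3 * t)" .
  have dbl: "x + 2 \<le> s * x" if "2 \<le> x" for x
    using mult_le_mono1[OF assms(1), of x] that by linarith
  have s2: "2 \<le> s ^ Suc k" for k
    using mult_le_mono[OF assms(1) p[of k]] by simp
  have "Suc (3 * t - 1) = 3 * t"
    using assms(2) by simp
  with s2[of "3 * t - 1"] have "s ^ (3 * t) + 2 \<le> s * s ^ (3 * t)"
    by (intro dbl) (simp only:)
  with 1 have "s * (s ^ t * (2 * t + 2) + 2) \<le> s * (s * s ^ (3 * t))"
    by (intro mult_left_mono) auto
  then have "s * (s ^ t * (2 * t + 2) + 2) + 2 \<le> s ^ (3 * t + 2) + 2"
    by (simp add: power_add power2_eq_square mult_ac)
  also have "\<dots> \<le> s ^ (3 * t + 3)"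
    using dbl[of "s ^ (3 * t + 2)"] s2[of "3 * t + 1"] by (simp add: eval_nat_numeral)
  also have "\<dots> \<le> s ^ (6 * t)"
    using assms by (intro power_increasing) auto
  finally show ?thesis .
qed

text \<open>The output gate adds 1, which at most doubles a bound that is at least 1; the doubling
  is paid by one more factor s.\<close>

lemma circuit_size_powr_bound:
  fixes s F c k :: nat and e :: real
  assumes "2 \<le> s" "real F \<le> real s powr e" "c \<le> s ^ k" "0 \<le> e"
  shows "real (F * c + 1) \<le> real s powr (e + real k + 1)"
proof -
  have "1 * 1 \<le> real s powr e * real s ^ k"
    using assms by (intro mult_mono ge_one_powr_ge_zero one_le_power) auto
  moreover have "real F * real c \<le> real s powr e * real s ^ k"
    using assms(2,3) by (intro mult_mono) (auto simp flip: of_nat_power)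
  ultimately have "real (F * c + 1) \<le> 2 * (real s powr e * real s ^ k)"
    by simp
  also have "\<dots> \<le> real s * (real s powr e * real s ^ k)"
    using assms(1) by (intro mult_right_mono) auto
  also have "\<dots> = real s powr (e + real k + 1)"
    using assms(1) by (simp add: powr_add powr_realpow)
  finally show ?thesis .
qed

text \<open>The constants 8 and 6 are the 4 and 3 of \<open>many_factors_expansion\<close>, doubled
  in passing from \<tau> = t - 1 to t. The 7 absorbs the extra 1 in the exponent
  \<open>6 * d / t + 6 * t + 1\<close>.\<close>

lemma depth_four_reduction:
  fixes \<phi> :: "'a::field formula"
  assumes \<phi>: "homogeneous_formula \<phi>" "formula_vars \<phi> \<subseteq> {..<n}"
    and t: "1 \<le> t" "t < formula_degree \<phi>"
  defines "d \<equiv> formula_degree \<phi>" and "s \<equiv> formula_size \<phi>" and "\<Delta> \<equiv> product_depth \<phi>"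
  shows "\<exists>C. wf_circuit n C \<and> circuit_poly C = formula_poly \<phi> \<and> homogeneous_circuit C \<and>
    depth_four_fanin (nat \<lfloor>real d / real t * real t powr (1 / real \<Delta>) / 8\<rfloor>) t C \<and>
    real (top_fanin C) \<le> real s powr (6 * (real d / real t)) \<and>
    real (circuit_size C) \<le> real s powr (7 * (real t + real d / real t))"
proof -
  have nz: "nonzero_homogeneous \<phi>"
    using \<phi>(1) t by (auto simp: nonzero_homogeneous_def)
  have hom: "hom_of_degree d (formula_poly \<phi>)"
    unfolding d_def by (rule homogeneous_formula_hom[OF \<phi>(1)])
  have \<Delta>: "1 \<le> \<Delta>"
    using formula_degree_depth_0[OF nz] t unfolding \<Delta>_def by linarith
  have s2: "2 \<le> s"
    using formula_degree_le_size[OF nz] t unfolding s_def by linarith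
  have dt: "1 \<le> real d / real t"
    using t by (simp add: d_def field_simps)
  define V where "V = formula_vars \<phi>"
  have V: "finite V" "card V \<le> s" "V \<subseteq> {..<n}" "mp_vars (formula_poly \<phi>) \<subseteq> V"
    using card_formula_vars \<phi>(2) mp_vars_formula_poly unfolding V_def s_def by blast+
  show ?thesis
  proof (cases "t = 1")
    case True
    from monomial_circuit[OF hom V(4,1,2,3) t(1)] obtain C where
      C: "wf_circuit n C" "circuit_poly C = formula_poly \<phi>" "homogeneous_circuit C" "depth_four_fanin d t C"
        "top_fanin C \<le> s ^ d" "circuit_size C \<le> s ^ d * ((d + 1) * (2 * t + 4) + 2) + 1"
      by blast
    \<comment> \<open>For t = 1 the required number is d / 8 rounded down, while every monomial has
      d variables as factors.\<close>
    have "depth_four_fanin (nat \<lfloor>real d / real t * real t powr (1 / real \<Delta>) / 8\<rfloor>) t C"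
      by (rule depth_four_fanin_mono[OF C(4)]) (use True in \<open>simp; linarith\<close>)
    moreover have "real (top_fanin C) \<le> real s powr (6 * (real d / real t))"
    proof -
      have "real (top_fanin C) \<le> real s ^ d"
        using C(5) by (metis of_nat_le_iff of_nat_power)
      also have "\<dots> = real s powr real d"
        using s2 by (simp add: powr_realpow)
      also have "\<dots> \<le> real s powr (6 * (real d / real t))"
        using s2 True by (intro powr_mono) auto
      finally show ?thesis .
    qed
    moreover have "real (circuit_size C) \<le> real s powr (7 * (real t + real d / real t))"
    proof -
      have "d + 1 \<le> 2 ^ d"
        by (induction d) auto
      also have "\<dots> \<le> s ^ d"
        using s2 by (intro power_mono) auto
      finally have d1: "d + 1 \<le> s ^ d" .
      have "(d + 1) * (2 * t + 4) + 2 \<le> (d + 1) * 2 ^ 3"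
        using True by simp
      also have "\<dots> \<le> s ^ d * s ^ 3"
        using d1 s2 by (intro mult_mono power_mono) auto
      also have "\<dots> = s ^ (d + 3)"
        by (simp add: power_add)
      finally have "(d + 1) * (2 * t + 4) + 2 \<le> s ^ (d + 3)" .
      moreover have "real (s ^ d) \<le> real s powr real d"
        using s2 by (simp add: powr_realpow)
      ultimately have "real (s ^ d * ((d + 1) * (2 * t + 4) + 2) + 1) \<le> real s powr (real d + real (d + 3) + 1)"
        using s2 by (intro circuit_size_powr_bound) auto
      also have "\<dots> \<le> real s powr (7 * (real t + real d / real t))"
        using s2 True by (intro powr_mono) auto
      finally show ?thesis
        using C(6) by (meson of_nat_le_iff order_trans)
    qed
    ultimately show ?thesis
      using C(1-3) by blast
  next
    case False
    \<comment> \<open>Here t is at least 2, so \<tau> is a legitimate threshold and t is at most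
      \<open>2 * \<tau>\<close>.\<close>
    define \<tau> where "\<tau> = t - 1"
    have \<tau>: "1 \<le> \<tau>" "\<tau> < formula_degree \<phi>" "\<tau> < t" "real t \<le> 2 * real \<tau>"
      using False t by (auto simp: \<tau>_def)
    from many_factors_expansion[OF nz \<tau>(1,2)] obtain Fs where
      Fs: "expansion [\<phi>] Fs" "real (length Fs) \<le> real s powr (3 * (real d / real \<tau>))"
        "\<And>T \<psi>. T \<in> set Fs \<Longrightarrow> \<psi> \<in> set T \<Longrightarrow> formula_degree \<psi> \<le> \<tau>"
        "\<And>T. T \<in> set Fs \<Longrightarrow> real d / real \<tau> * real \<tau> powr (1 / real \<Delta>) / 4 \<le> real (nonconst_count T)"
      unfolding d_def s_def \<Delta>_def by blast
    have ref: "refinement [\<phi>] T" if "T \<in> set Fs" for T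
      using Fs(1) that by (simp add: expansion_def)
    have d\<tau>: "real d / real \<tau> \<le> 2 * (real d / real t)"
      using \<tau> t(1) by (simp add: field_simps) (metis mult.assoc mult.commute mult_left_mono of_nat_0_le_iff)
    let ?a = "nat \<lfloor>real d / real t * real t powr (1 / real \<Delta>) / 8\<rfloor>"
    let ?Ts = "map (map formula_poly) Fs"
    \<comment> \<open>The root of 2 that appears is at most 2 because \<Delta> is at least 1, and
      replacing d / t by the larger \<open>d / \<tau>\<close> loses nothing.\<close>
    have "real d / real t * real t powr (1 / real \<Delta>) / 8 \<le> real d / real \<tau> * real \<tau> powr (1 / real \<Delta>) / 4"
    proof -
      have "real t powr (1 / real \<Delta>) \<le> (2 * real \<tau>) powr (1 / real \<Delta>)"
        using \<tau>(4) by (intro powr_mono2) auto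
      also have "\<dots> = 2 powr (1 / real \<Delta>) * real \<tau> powr (1 / real \<Delta>)"
        by (simp add: powr_mult)
      also have "\<dots> \<le> 2 powr 1 * real \<tau> powr (1 / real \<Delta>)"
        using \<Delta> by (intro mult_right_mono powr_mono) auto
      finally have "real t powr (1 / real \<Delta>) \<le> 2 * real \<tau> powr (1 / real \<Delta>)"
        by simp
      moreover have "real d / real t \<le> real d / real \<tau>"
        using \<tau> by (intro divide_left_mono) auto
      ultimately have "real d / real t * real t powr (1 / real \<Delta>) \<le> real d / real \<tau> * (2 * real \<tau> powr (1 / real \<Delta>))"
        by (intro mult_mono) auto
      also have "\<dots> = 2 * (real d / real \<tau> * real \<tau> powr (1 / real \<Delta>))"
        by (rule mult.left_commute)
      finally have "real d / real t * real t powr (1 / real \<Delta>) / 8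
          \<le> 2 * (real d / real \<tau> * real \<tau> powr (1 / real \<Delta>)) / 8"
        by (rule divide_right_mono) simp
      then show ?thesis by simp
    qed
    then have count: "?a \<le> nonconst_count T" if "T \<in> set Fs" for T
      using Fs(4)[OF that] by linarith
    have "\<exists>C. wf_circuit n C \<and> circuit_poly C = formula_poly \<phi> \<and> homogeneous_circuit C \<and> depth_four_fanin ?a t C \<and>
      top_fanin C = length ?Ts \<and> circuit_size C \<le> length ?Ts * (s * (s ^ t * (2 * t + 2) + 2) + 2) + 1"
    proof (rule depth_four_circuit[where V = V])
      show "homogeneous_poly (formula_poly \<phi>)"
        by (rule hom_of_degree_imp_homogeneous[OF hom])
      show "formula_poly \<phi> = sum_list (map prod_list ?Ts)"
        using Fs(1) by (simp add: expansion_def o_def)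
    next
      fix P assume "P \<in> set ?Ts"
      then obtain T where T: "T \<in> set Fs" "P = map formula_poly T"
        by auto
      \<comment> \<open>Every factor has size at least 1, and the sizes in a term add up to at most
        s.\<close>
      have "(\<Sum>\<psi>\<leftarrow>T. 1) \<le> (\<Sum>\<psi>\<leftarrow>T. formula_size \<psi>)"
        by (rule sum_list_mono) (simp add: Suc_le_eq formula_size_pos)
      then have "length T \<le> (\<Sum>\<psi>\<leftarrow>T. formula_size \<psi>)"
        by (simp add: sum_list_triv)
      then show "length P \<le> s"
        using ref[OF T(1)] T(2) by (simp add: refinement_def s_def)
      show "?a \<le> length (filter (\<lambda>p. total_degree p > 0) P)"
        using count[OF T(1)] T(2) by (simp add: nonconst_count_def filter_map o_def)
      show "sum_of_leaf_products V t (s ^ t) p" if p: "p \<in> set P" for p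
      proof -
        from p T(2) obtain \<psi> where \<psi>: "\<psi> \<in> set T" "p = formula_poly \<psi>"
          by auto
        have "nonzero_homogeneous \<psi>" "refined_by \<phi> \<psi>"
          using ref[OF T(1)] \<psi>(1) by (auto simp: refinement_def)
        then have "hom_of_degree (formula_degree \<psi>) p" "mp_vars p \<subseteq> V"
          using homogeneous_formula_hom[of \<psi>] mp_vars_formula_poly[of \<psi>] \<psi>(2)
          unfolding nonzero_homogeneous_def refined_by_def V_def by auto
        then show ?thesis
          using V(1,2) s2 Fs(3)[OF T(1) \<psi>(1)] \<tau>(3) 
            by (intro sum_of_leaf_products_low_degree[where k = "formula_degree \<psi>"]) auto
      qed
    qed (rule V(3))
    then obtain C where C: "wf_circuit n C" "circuit_poly C = formula_poly \<phi>" "homogeneous_circuit C"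
      "depth_four_fanin ?a t C" "top_fanin C = length Fs"
      "circuit_size C \<le> length Fs * (s * (s ^ t * (2 * t + 2) + 2) + 2) + 1"
      unfolding length_map by blast
    have F: "real (length Fs) \<le> real s powr (6 * (real d / real t))"
      using Fs(2)
    proof (rule order_trans)
      show "real s powr (3 * (real d / real \<tau>)) \<le> real s powr (6 * (real d / real t))"
        using s2 d\<tau> by (intro powr_mono) auto
    qed
    have "real (circuit_size C) \<le> real (length Fs * (s * (s ^ t * (2 * t + 2) + 2) + 2) + 1)"
      using C(6) by (rule of_nat_mono)
    also have "\<dots> \<le> real s powr (6 * (real d / real t) + real (6 * t) + 1)"
      using s2 F size_bound_aux[OF s2 t(1)] by (rule circuit_size_powr_bound) simp
    also have "\<dots> \<le> real s powr (7 * (real t + real d / real t))"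
    proof (rule powr_mono)
      have "6 * x + 6 * y + 1 \<le> 7 * (y + x)" if "1 \<le> x" "1 \<le> y" for x y :: real
        using that by simp
      moreover have "1 \<le> real t"
        using t(1) by simp
      ultimately have "6 * (real d / real t) + 6 * real t + 1 \<le> 7 * (real t + real d / real t)"
        using dt by blast
      then show "6 * (real d / real t) + real (6 * t) + 1 \<le> 7 * (real t + real d / real t)"
        by (simp only: of_nat_mult of_nat_numeral)
    qed (use s2 in simp)
    finally show ?thesis
      using C(1-5) F by auto
  qed
qed

section \<open>The asymptotic statement for families of formulas\<close>

theorem theorem4p2:
  fixes f :: "nat \<Rightarrow> 'a::field mpoly"
    and \<Phi> :: "nat \<Rightarrow> 'a formula"
    and n d s \<Delta> t :: "nat \<Rightarrow> nat"
  assumes "\<And>m. mp_vars (f m) \<subseteq> {..<n m}"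
    and "\<And>m. total_degree (f m) = d m"
    and "\<And>m. formula_vars (\<Phi> m) \<subseteq> {..<n m}"
    and "\<And>m. formula_poly (\<Phi> m) = f m"
    and "\<And>m. homogeneous_formula (\<Phi> m)"
    and "\<And>m. formula_size (\<Phi> m) = s m"
    and "\<And>m. product_depth (\<Phi> m) = \<Delta> m"
    and "\<And>m. t m \<ge> 1"
    and "(\<lambda>m. real (t m)) \<in> o(\<lambda>m. real (d m))"
  shows "\<exists>(a :: nat \<Rightarrow> nat) (C :: nat \<Rightarrow> 'a circuit) (e\<^sub>1 :: nat \<Rightarrow> real) (e\<^sub>2 :: nat \<Rightarrow> real).
      (\<forall>m. wf_circuit (n m) (C m) \<and> circuit_poly (C m) = f m \<and>
           homogeneous_circuit (C m) \<and> depth_four_fanin (a m) (t m) (C m)) \<and>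
      (\<lambda>m. real (a m)) \<in> \<Theta>(\<lambda>m. real (d m) / real (t m) * real (t m) powr (1 / real (\<Delta> m))) \<and>
      e\<^sub>1 \<in> O(\<lambda>m. real (d m) / real (t m)) \<and>
      e\<^sub>2 \<in> O(\<lambda>m. real (t m) + real (d m) / real (t m)) \<and>
      (\<forall>\<^sub>F m in sequentially. real (top_fanin (C m)) \<le> real (s m) powr e\<^sub>1 m \<and>
           real (circuit_size (C m)) \<le> real (s m) powr e\<^sub>2 m)"
proof -
  define x where "x = (\<lambda>m. real (d m) / real (t m) * real (t m) powr (1 / real (\<Delta> m)))"
  \<comment> \<open>A circuit must be given for every index, but the reduction covers only
    \<open>t m < d m\<close>. Elsewhere the circuit of monomials is taken with a = 0; these indices
    are finitely many, so the asymptotics are unaffected.\<close>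
  define a where "a = (\<lambda>m. if t m < d m then nat \<lfloor>x m / 8\<rfloor> else 0)"
  define e\<^sub>1 where "e\<^sub>1 = (\<lambda>m. 6 * (real (d m) / real (t m)))"
  define e\<^sub>2 where "e\<^sub>2 = (\<lambda>m. 7 * (real (t m) + real (d m) / real (t m)))"
  have "\<exists>C. wf_circuit (n m) C \<and> circuit_poly C = f m \<and> homogeneous_circuit C \<and>
      depth_four_fanin (a m) (t m) C \<and>
      (t m < d m \<longrightarrow> real (top_fanin C) \<le> real (s m) powr e\<^sub>1 m \<and> real (circuit_size C) \<le> real (s m) powr e\<^sub>2 m)"
    for m
  proof (cases "t m < d m")
    case True
    then show ?thesis
      using depth_four_reduction[OF assms(5,3,8), of m] assms(2,4,6,7)
      by (simp add: a_def x_def e\<^sub>1_def e\<^sub>2_def)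
  next
    case False
    have "hom_of_degree (d m) (f m)"
      using homogeneous_formula_hom[OF assms(5), of m] assms(2,4) by simp
    moreover have "mp_vars (f m) \<subseteq> formula_vars (\<Phi> m)" "finite (formula_vars (\<Phi> m))"
      using mp_vars_formula_poly[of "\<Phi> m"] card_formula_vars[of "\<Phi> m"] assms(4) by auto
    ultimately obtain C where
      "wf_circuit (n m) C" "circuit_poly C = f m" "homogeneous_circuit C" "depth_four_fanin (d m) (t m) C"
      using monomial_circuit[OF _ _ _ order_refl assms(3)[of m] assms(8)[of m]] by blast
    with False show ?thesis
      using depth_four_fanin_mono[of "d m" "t m" C 0] by (auto simp: a_def)
  qed
  then obtain C where C: "\<And>m. wf_circuit (n m) (C m) \<and> circuit_poly (C m) = f m \<and> homogeneous_circuit (C m) \<and>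
      depth_four_fanin (a m) (t m) (C m) \<and>
      (t m < d m \<longrightarrow> real (top_fanin (C m)) \<le> real (s m) powr e\<^sub>1 m \<and>
         real (circuit_size (C m)) \<le> real (s m) powr e\<^sub>2 m)"
    by metis
  \<comment> \<open>The ratio 1 / 16 makes \<open>x m / 8\<close> at least 2, so that rounding it
    down leaves at least half of it, \<open>x m / 16\<close>.\<close>
  have "\<forall>\<^sub>F m in sequentially. norm (real (t m)) \<le> 1 / 16 * norm (real (d m))"
    by (rule landau_o.smallD[OF assms(9)]) simp
  then have large: "\<forall>\<^sub>F m in sequentially. t m < d m \<and> 16 \<le> x m"
  proof (rule eventually_mono)
    fix m assume "norm (real (t m)) \<le> 1 / 16 * norm (real (d m))"
    then have le: "16 * real (t m) \<le> real (d m)" by simp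
    have t: "1 \<le> real (t m)" using assms(8)[of m] by simp
    \<comment> \<open>This also holds if \<open>\<Delta> m\<close> is 0: then
      \<open>1 / real (\<Delta> m)\<close> is 0 by convention and the power is 1.\<close>
    have "16 * 1 \<le> real (d m) / real (t m) * real (t m) powr (1 / real (\<Delta> m))"
      using le t by (intro mult_mono ge_one_powr_ge_zero) (auto simp: field_simps)
    with le t show "t m < d m \<and> 16 \<le> x m"
      by (simp add: x_def)
  qed
  have a: "\<forall>\<^sub>F m in sequentially. x m / 16 \<le> real (a m) \<and> real (a m) \<le> x m \<and> 0 \<le> x m"
    using large
  proof (rule eventually_mono)
    fix m assume m: "t m < d m \<and> 16 \<le> x m"
    then have "real (a m) = real_of_int \<lfloor>x m / 8\<rfloor>"
      by (simp add: a_def)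
    then show "x m / 16 \<le> real (a m) \<and> real (a m) \<le> x m \<and> 0 \<le> x m"
      using m by linarith
  qed
  have "(\<lambda>m. real (a m)) \<in> \<Theta>(x)"
  proof (rule bigthetaI)
    show "(\<lambda>m. real (a m)) \<in> O(x)"
      by (rule landau_o.bigI[of 1]) (use a in \<open>auto elim!: eventually_mono\<close>)
    show "(\<lambda>m. real (a m)) \<in> \<Omega>(x)"
      by (rule landau_omega.bigI[of "1 / 16"]) (use a in \<open>auto elim!: eventually_mono\<close>)
  qed
  moreover have "e\<^sub>1 \<in> O(\<lambda>m. real (d m) / real (t m))" "e\<^sub>2 \<in> O(\<lambda>m. real (t m) + real (d m) / real (t m))"
  proof -
    have "(\<lambda>m. c * g m) \<in> O(g)" for c :: real and g :: "nat \<Rightarrow> real"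
      by simp
    note scaled = this
    show "e\<^sub>1 \<in> O(\<lambda>m. real (d m) / real (t m))"
      unfolding e\<^sub>1_def by (rule scaled)
    show "e\<^sub>2 \<in> O(\<lambda>m. real (t m) + real (d m) / real (t m))"
      unfolding e\<^sub>2_def by (rule scaled)
  qed
  moreover have "\<forall>\<^sub>F m in sequentially. real (top_fanin (C m)) \<le> real (s m) powr e\<^sub>1 m \<and>
      real (circuit_size (C m)) \<le> real (s m) powr e\<^sub>2 m"
    using large by (rule eventually_mono) (use C in blast)
  ultimately show ?thesis
    using C unfolding x_def by blast
qed

end
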